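(* Let $\Omega$ be a domain in $\mathbb{R}^n$, $n\ge 3$. Assume that for some point $\mathbf{p}\in b\Omega$ there exist a neighbourhood $U\subset\mathbb{R}^n$ of $\mathbf{p}$ and a continuous function $u:\overline\Omega\cap U\to(-\infty,0]$ such that $u(\mathbf{p})=0$, $u<0$ on $(\overline\Omega\cap U)\setminus\{\mathbf{p}\}$, $u$ is MPSH on $\Omega\cap U$, and $$|u(\mathbf{x})|\le c_0|\mathbf{x}-\mathbf{p}|,\quad \mathbf{x}\in\Omega\cap U$$ holds for some $c_0>0$. Given $r_0>0$, there is a constant $c>0$ such that $$g_\Omega(\mathbf{x},\mathbf{v})\ge(1-c|\mathbf{x}-\mathbf{p}|)\,g_{\Omega\cap\mathbb{B}(\mathbf{p},r_0)}(\mathbf{x},\mathbf{v}),\quad \mathbf{x}\in\Omega\cap\mathbb{B}(\mathbf{p},r_0),\ \mathbf{v}\in\mathbb{R}^n.$$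
   Context: A domain is a nonempty connected open set; $b\Omega$ is the topological boundary; $\mathbb{B}(\mathbf{p},r)$ is the open Euclidean ball of radius $r$ centred at $\mathbf{p}$. $\mathbb{D}=\{z=x+iy\in\mathbb{C}:|z|<1\}$. A $C^1$ map $f$ from an open subset of $\mathbb{R}^2=\mathbb{C}$ to $\mathbb{R}^n$ is conformal if $|f_x|=|f_y|$ and $f_x\cdot f_y=0$ at every point (it need not be an immersion). For an open set $\Omega\subset\mathbb{R}^n$, $\mathrm{CH}(\mathbb{D},\Omega)$ denotes the set of all conformal harmonic maps $\mathbb{D}\to\Omega$, and the minimal pseudometric is $$g_\Omega(\mathbf{x},\mathbf{v})=\inf\{1/r>0:\exists f\in \mathrm{CH}(\mathbb{D},\Omega),\ f(0)=\mathbf{x},\ f_x(0)=r\mathbf{v}\},\quad \mathbf{x}\in\Omega,\ \mathbf{v}\in\mathbb{R}^n.$$ An upper-semicontinuous function $u:\Omega'\to[-\infty,+\infty)$ on an open set $\Omega'\subset\mathbb{R}^n$ is minimal plurisubharmonic (MPSH) if for every affine $2$-plane $L\subset\mathbb{R}^n$ the restriction of $u$ to $L\cap\Omega'$ is subharmonic in conformal linear coordinates on $L$. *)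

theory Defs
  imports "HOL-Analysis.Analysis"
begin

definition domain :: "'a::euclidean_space set \<Rightarrow> bool" where
  "domain \<Omega> \<longleftrightarrow> open \<Omega> \<and> connected \<Omega> \<and> \<Omega> \<noteq> {}"

definition partial_x :: "(complex \<Rightarrow> 'a::euclidean_space) \<Rightarrow> complex \<Rightarrow> 'a" where
  "partial_x f z = frechet_derivative f (at z) 1"

definition partial_y :: "(complex \<Rightarrow> 'a::euclidean_space) \<Rightarrow> complex \<Rightarrow> 'a" where
  "partial_y f z = frechet_derivative f (at z) \<i>"

text \<open>The next four notions are meant for an open set \<open>D\<close>.\<close>

definition C1_map_on :: "(complex \<Rightarrow> 'a::euclidean_space) \<Rightarrow> complex set \<Rightarrow> bool" where
  "C1_map_on f D \<longleftrightarrow> (\<forall>z\<in>D. f differentiable (at z)) \<and>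
     continuous_on D (partial_x f) \<and> continuous_on D (partial_y f)"

definition C2_map_on :: "(complex \<Rightarrow> 'a::euclidean_space) \<Rightarrow> complex set \<Rightarrow> bool" where
  "C2_map_on f D \<longleftrightarrow> C1_map_on f D \<and> C1_map_on (partial_x f) D \<and> C1_map_on (partial_y f) D"

definition harmonic_map_on :: "(complex \<Rightarrow> 'a::euclidean_space) \<Rightarrow> complex set \<Rightarrow> bool" where
  "harmonic_map_on f D \<longleftrightarrow> C2_map_on f D \<and>
     (\<forall>z\<in>D. partial_x (partial_x f) z + partial_y (partial_y f) z = 0)"

definition conformal_map_on :: "(complex \<Rightarrow> 'a::euclidean_space) \<Rightarrow> complex set \<Rightarrow> bool" where
  "conformal_map_on f D \<longleftrightarrow> C1_map_on f D \<and>
     (\<forall>z\<in>D. norm (partial_x f z) = norm (partial_y f z) \<and> partial_x f z \<bullet> partial_y f z = 0)"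

text \<open>\<open>CH D \<Omega>\<close> is the set of conformal harmonic maps \<open>D \<rightarrow> \<Omega>\<close>. Such a map is represented by any
  total function that restricts to it; values outside \<open>D\<close> are irrelevant when \<open>D\<close> is open.\<close>

definition CH :: "complex set \<Rightarrow> 'a::euclidean_space set \<Rightarrow> (complex \<Rightarrow> 'a) set" where
  "CH D \<Omega> = {f. f ` D \<subseteq> \<Omega> \<and> conformal_map_on f D \<and> harmonic_map_on f D}"

text \<open>For \<open>\<Omega>\<close> open, \<open>x \<in> \<Omega>\<close> and dimension at least two, small affine conformal discs through \<open>x\<close>
  show that the set below is nonempty; it is bounded below by \<open>0\<close>. The infimum in \<open>real\<close> is
  therefore the genuine one.\<close>

definition minimal_pseudometric :: "'a::euclidean_space set \<Rightarrow> 'a \<Rightarrow> 'a \<Rightarrow> real" where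
  "minimal_pseudometric \<Omega> x v =
     Inf {1 / r | r. 1 / r > 0 \<and> (\<exists>f \<in> CH (ball 0 1) \<Omega>. f 0 = x \<and> partial_x f 0 = r *\<^sub>R v)}"

definition upper_semicontinuous_on ::
    "'a::topological_space set \<Rightarrow> ('a \<Rightarrow> ereal) \<Rightarrow> bool" where
  "upper_semicontinuous_on S u \<longleftrightarrow> (\<forall>a. openin (top_of_set S) {x \<in> S. u x < a})"

text \<open>Mean value over the circle \<open>|z - a| = r\<close>, as an extended Lebesgue integral (positive part minus
  negative part; \<open>e2ennreal\<close> sends negative numbers to \<open>0\<close>). For \<open>u\<close> upper semicontinuous and
  \<open>< \<infinity>\<close> on the circle the positive part is finite, so the difference is meaningful
  and may equal \<open>-\<infinity>\<close>.\<close>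

definition circle_mean :: "(complex \<Rightarrow> ereal) \<Rightarrow> complex \<Rightarrow> real \<Rightarrow> ereal" where
  "circle_mean u a r =
     (enn2ereal (\<integral>\<^sup>+t\<in>{0..2*pi}. e2ennreal (u (a + of_real r * cis t)) \<partial>lborel)
      - enn2ereal (\<integral>\<^sup>+t\<in>{0..2*pi}. e2ennreal (- u (a + of_real r * cis t)) \<partial>lborel))
     / ereal (2 * pi)"

text \<open>The function that is identically \<open>-\<infinity>\<close> is admitted.\<close>

definition subharmonic_on :: "complex set \<Rightarrow> (complex \<Rightarrow> ereal) \<Rightarrow> bool" where
  "subharmonic_on W u \<longleftrightarrow> open W \<and> (\<forall>z\<in>W. u z < \<infinity>) \<and> upper_semicontinuous_on W u \<and>
     (\<forall>a r. r > 0 \<and> cball a r \<subseteq> W \<longrightarrow> u a \<le> circle_mean u a r)"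

text \<open>\<open>\<phi>\<close> is the parametrization of the plane \<open>L\<close> by conformal linear coordinates \<open>z = x + iy\<close>.\<close>

definition conformal_linear_coords ::
    "'a::euclidean_space set \<Rightarrow> (complex \<Rightarrow> 'a) \<Rightarrow> bool" where
  "conformal_linear_coords L \<phi> \<longleftrightarrow>
     (\<exists>a e1 e2. e1 \<noteq> 0 \<and> norm e1 = norm e2 \<and> e1 \<bullet> e2 = 0 \<and>
        \<phi> = (\<lambda>z. a + Re z *\<^sub>R e1 + Im z *\<^sub>R e2) \<and> range \<phi> = L)"

definition MPSH_on :: "'a::euclidean_space set \<Rightarrow> ('a \<Rightarrow> ereal) \<Rightarrow> bool" where
  "MPSH_on \<Omega> u \<longleftrightarrow> open \<Omega> \<and> (\<forall>x\<in>\<Omega>. u x < \<infinity>) \<and> upper_semicontinuous_on \<Omega> u \<and>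
     (\<forall>L \<phi>. affine L \<and> aff_dim L = 2 \<and> conformal_linear_coords L \<phi> \<longrightarrow>
        subharmonic_on (\<phi> -` \<Omega>) (u \<circ> \<phi>))"

end

theory Submission
  imports Defs
begin

text \<open>Let \<open>f\<close> be a conformal harmonic disc in \<open>\<Omega>\<close> with \<open>f 0 = x\<close> close to \<open>p\<close>, and let \<open>z0\<close> be a
  point at which \<open>f\<close> reaches a small sphere around \<open>p\<close>, at \<open>q = f z0\<close>. Gluing the peak function \<open>u\<close>
  to a constant, making it strictly MPSH away from \<open>p\<close> and adding a cut off logarithm
  \<open>A log |x - q|\<^sup>2\<close>, one obtains a function \<open>\<Lambda> \<le> 0\<close> on \<open>\<Omega>\<close>, MPSH off \<open>q\<close>, which equals \<open>u\<close> near \<open>p\<close>;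
  \<open>A\<close> does not depend on \<open>q\<close>.
  Then \<open>\<Lambda> \<circ> f\<close> plus a multiple of the Green function of the disc with pole at \<open>z0\<close> is
  subharmonic and nonpositive on the circle, and its value at \<open>0\<close> gives
  \<open>A log (1 / |z0|) \<le> - u x \<le> c0 |x - p|\<close>. Hence \<open>f\<close> stays near \<open>p\<close> on the disc of radius
  \<open>1 - c |x - p|\<close>, and rescaling this disc to the unit disc compares the two pseudometrics.

  Subharmonicity of \<open>\<Lambda> \<circ> f\<close> for merely continuous \<open>\<Lambda>\<close> is replaced by a viscosity argument:
  MPSH is used only through the traces of 2-jets touching \<open>\<Lambda>\<close> from above along conformal planes.\<close>

section \<open>Second-order expansions\<close>

text \<open>MPSH speaks of affine planes only, while the image of \<open>f\<close> is a curved and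
  possibly branched surface, so a quadratic touching the composition from above says nothing
  directly about the function on a plane. Doubling the variables decouples the two: the function
  moves along a tangent plane, and the bending of the surface enters only through a quadratic
  penalty.

  The radii leave room for every modification. The pole \<open>q\<close> has distance
  \<open>4 * s\<close> from \<open>p\<close> and its logarithm is cut off at distance
  \<open>2 * s\<close>, so it acts only between the radii \<open>2 * s\<close> and
  \<open>6 * s\<close> around \<open>p\<close>. There the added multiple of the squared distance,
  active beyond \<open>s\<close>, already has positive trace, and the constant, which can enter only
  beyond \<open>8 * s\<close>, is not yet present. A cut off logarithm is not MPSH; the positive
  trace pays for the defect, and this determines the constant in front of the logarithm.

  Along \<open>f\<close> the pole of the barrier is at least twice as strong as that of the Green
  term. Their sum therefore still tends to minus infinity at \<open>z0\<close>, and no removable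
  singularity has to be analysed.\<close>

definition upper_o2 :: "('a::real_normed_vector \<Rightarrow> real) \<Rightarrow> bool" where
  "upper_o2 f \<longleftrightarrow> (\<forall>e>0. \<forall>\<^sub>F w in nhds 0. f w \<le> e * (norm w)\<^sup>2)"

text \<open>Here \<open>a\<close> and \<open>c\<close> are half the pure second derivatives, so
  \<open>a + c\<close> is half a Laplacian, the only combination of coefficients whose sign matters.
  Vector values are allowed because the disc map is expanded in the same form.\<close>

definition quad :: "'b::real_vector \<Rightarrow> 'b \<Rightarrow> 'b \<Rightarrow> 'b \<Rightarrow> 'b \<Rightarrow> complex \<Rightarrow> 'b" where
  "quad l1 l2 a b c w = Re w *\<^sub>R l1 + Im w *\<^sub>R l2
     + (Re w)\<^sup>2 *\<^sub>R a + (Re w * Im w) *\<^sub>R b + (Im w)\<^sup>2 *\<^sub>R c"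

lemma upper_o2_mono:
  assumes "upper_o2 g" "\<forall>\<^sub>F w in nhds 0. f w \<le> g w"
  shows "upper_o2 f"
  unfolding upper_o2_def
proof (intro allI impI)
  fix e :: real assume "e > 0"
  with assms(1) have "\<forall>\<^sub>F w in nhds 0. g w \<le> e * (norm w)\<^sup>2" by (auto simp: upper_o2_def)
  with assms(2) show "\<forall>\<^sub>F w in nhds 0. f w \<le> e * (norm w)\<^sup>2"
    by eventually_elim linarith
qed

lemma upper_o2_add:
  assumes "upper_o2 f" "upper_o2 g"
  shows "upper_o2 (\<lambda>w. f w + g w)"
  unfolding upper_o2_def
proof (intro allI impI)
  fix e :: real assume "e > 0"
  then have "\<forall>\<^sub>F w in nhds 0. f w \<le> (e/2) * (norm w)\<^sup>2" "\<forall>\<^sub>F w in nhds 0. g w \<le> (e/2) * (norm w)\<^sup>2"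
    using assms by (auto simp: upper_o2_def dest!: spec[of _ "e/2"])
  then show "\<forall>\<^sub>F w in nhds 0. f w + g w \<le> e * (norm w)\<^sup>2"
    by eventually_elim (simp add: algebra_simps)
qed

lemma upper_o2_cmult:
  assumes "upper_o2 f" "k \<ge> 0"
  shows "upper_o2 (\<lambda>w. k * f w)"
  unfolding upper_o2_def
proof (intro allI impI)
  fix e :: real assume "e > 0"
  then have "e / (k + 1) > 0" using assms(2) by simp
  then have "\<forall>\<^sub>F w in nhds 0. f w \<le> (e/(k+1)) * (norm w)\<^sup>2"
    using assms(1) by (auto simp: upper_o2_def)
  then show "\<forall>\<^sub>F w in nhds 0. k * f w \<le> e * (norm w)\<^sup>2"
  proof eventually_elim
    case (elim w)
    have "k * f w \<le> k * ((e/(k+1)) * (norm w)\<^sup>2)" using elim assms(2) by (rule mult_left_mono)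
    also have "\<dots> = (k/(k+1)) * (e * (norm w)\<^sup>2)" by simp
    also have "\<dots> \<le> 1 * (e * (norm w)\<^sup>2)"
      by (rule mult_right_mono) (use assms(2) \<open>e > 0\<close> in auto)
    finally show ?case by simp
  qed
qed

lemma eventually_norm_less:
  fixes d :: real assumes "d > 0"
  shows "\<forall>\<^sub>F w in nhds (0::'a::real_normed_vector). norm w < d"
  unfolding eventually_nhds_metric using assms by (auto simp: dist_norm)

lemma upper_o2_cube:
  assumes "\<forall>\<^sub>F w in nhds 0. f w \<le> C * (norm w) ^ 3"
  shows "upper_o2 f"
  unfolding upper_o2_def
proof (intro allI impI)
  fix e :: real assume e: "e > 0"
  have "\<forall>\<^sub>F w in nhds (0::'a). norm w < e / (\<bar>C\<bar> + 1)"
    by (rule eventually_norm_less) (use e in simp)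
  with assms show "\<forall>\<^sub>F w in nhds 0. f w \<le> e * (norm w)\<^sup>2"
  proof eventually_elim
    case (elim w)
    have "C * norm w \<le> (\<bar>C\<bar> + 1) * norm w" by (intro mult_right_mono) auto
    also have "\<dots> \<le> e" using elim(2) by (simp add: field_simps)
    finally have "(C * norm w) * (norm w)\<^sup>2 \<le> e * (norm w)\<^sup>2" by (intro mult_right_mono) auto
    with elim(1) show ?case by (simp add: power3_eq_cube power2_eq_square mult.assoc)
  qed
qed

lemma upper_o2_0: "upper_o2 (\<lambda>w. 0)"
  by (simp add: upper_o2_def)

text \<open>Summing over the four points t, -t, it, -it removes the linear and the mixed terms and
  isolates the trace.\<close>

lemma upper_o2_quad_trace_nonneg:
  assumes "upper_o2 (\<lambda>w. - quad l1 l2 a b c w)"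
  shows "a + c \<ge> (0::real)"
proof (rule ccontr)
  assume neg: "\<not> a + c \<ge> 0"
  define e where "e = - (a + c) / 4"
  have "e > 0" using neg by (simp add: e_def)
  then obtain d where d: "d > 0" "\<And>w. norm w < d \<Longrightarrow> - quad l1 l2 a b c w \<le> e * (norm w)\<^sup>2"
    using assms unfolding upper_o2_def eventually_nhds_metric dist_norm by fastforce
  define t where "t = d / 2"
  have t: "t > 0" "t < d" using d by (auto simp: t_def)
  have "- quad l1 l2 a b c (of_real t) - quad l1 l2 a b c (- of_real t)
      - quad l1 l2 a b c (\<i> * of_real t) - quad l1 l2 a b c (- (\<i> * of_real t)) \<le> 4 * (e * t\<^sup>2)"
    using d(2)[of "of_real t"] d(2)[of "- of_real t"] d(2)[of "\<i> * of_real t"]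
      d(2)[of "- (\<i> * of_real t)"] t by (simp add: norm_mult)
  then have "- 2 * (a + c) * t\<^sup>2 \<le> 4 * e * t\<^sup>2" by (simp add: quad_def algebra_simps)
  then have "- 2 * (a + c) \<le> 4 * e" using t by simp
  then show False using neg by (simp add: e_def)
qed

text \<open>The derivative \<open>D\<close> is required to be differentiable at the single point
  \<open>z\<close> only, with derivative \<open>B\<close>. Subtracting the expected polynomial along
  a segment leaves a path of speed at most \<open>e * (norm w)\<^sup>2\<close>, so the mean value
  inequality suffices.\<close>

lemma second_order_taylor:
  fixes F :: "'a::real_normed_vector \<Rightarrow> 'b::real_normed_vector"
  assumes ev: "\<forall>\<^sub>F x in nhds z. (F has_derivative D x) (at x)"
    and B: "\<And>e. e > 0 \<Longrightarrow>
      \<forall>\<^sub>F h in nhds 0. \<forall>w. norm (D (z + h) w - D z w - B h w) \<le> e * norm h * norm w"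
    and lin: "\<And>t w. B (t *\<^sub>R w) w = t *\<^sub>R B w w"
  shows "upper_o2 (\<lambda>w. norm (F (z + w) - F z - D z w - (1/2) *\<^sub>R B w w))"
  unfolding upper_o2_def
proof (intro allI impI)
  fix e :: real assume e: "e > 0"
  obtain d1 where d1: "d1 > 0" "\<And>x. dist x z < d1 \<Longrightarrow> (F has_derivative D x) (at x)"
    using ev unfolding eventually_nhds_metric by auto
  obtain d2 where d2: "d2 > 0"
    "\<And>h w. norm h < d2 \<Longrightarrow> norm (D (z + h) w - D z w - B h w) \<le> e * norm h * norm w"
    using B[OF e] unfolding eventually_nhds_metric dist_norm by auto
  have "norm (F (z + w) - F z - D z w - (1/2) *\<^sub>R B w w) \<le> e * (norm w)\<^sup>2"
    if w: "norm w < min d1 d2" for w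
  proof -
    define \<phi> where "\<phi> = (\<lambda>t. F (z + t *\<^sub>R w) - t *\<^sub>R D z w - (t\<^sup>2/2) *\<^sub>R B w w)"
    have small: "norm (t *\<^sub>R w) \<le> norm w" if "t \<in> {0..1}" for t
      using that by (auto intro: mult_left_le_one_le)
    have der: "(\<phi> has_derivative (\<lambda>s. s *\<^sub>R (D (z + t *\<^sub>R w) w - D z w - t *\<^sub>R B w w)))
        (at t within {0..1})" if t: "t \<in> {0..1}" for t
    proof -
      have "(F has_derivative D (z + t *\<^sub>R w)) (at (z + t *\<^sub>R w))"
        by (rule d1(2)) (use small[OF t] w in \<open>auto simp: dist_norm\<close>)
      then have FD: "(F has_derivative D (z + t *\<^sub>R w)) (at (z + t *\<^sub>R w))"
        and lD: "linear (D (z + t *\<^sub>R w))"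
        by (auto dest: has_derivative_linear)
      have "((\<lambda>t. z + t *\<^sub>R w) has_derivative (\<lambda>s. s *\<^sub>R w)) (at t within {0..1})"
        by (auto intro!: derivative_eq_intros)
      note FD = has_derivative_compose[OF this FD]
      have sq: "((\<lambda>t. (t\<^sup>2/2) *\<^sub>R B w w) has_derivative (\<lambda>s. (s * t) *\<^sub>R B w w)) (at t within {0..1})"
        by (auto intro!: derivative_eq_intros simp: algebra_simps)
      have lin1: "((\<lambda>t. t *\<^sub>R D z w) has_derivative (\<lambda>s. s *\<^sub>R D z w)) (at t within {0..1})"
        by (auto intro!: derivative_eq_intros)
      show ?thesis unfolding \<phi>_def
        using has_derivative_diff[OF has_derivative_diff[OF FD lin1] sq]
        by (simp add: linear_scale[OF lD] scaleR_diff_right)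
    qed
    have "norm (\<phi> 1 - \<phi> 0) \<le> (e * (norm w)\<^sup>2) * norm (1 - 0 :: real)"
    proof (rule differentiable_bound[OF _ der])
      fix t :: real assume t: "t \<in> {0..1}"
      have "norm (D (z + t *\<^sub>R w) w - D z w - t *\<^sub>R B w w) \<le> e * norm (t *\<^sub>R w) * norm w"
        using d2(2)[of "t *\<^sub>R w" w] small[OF t] w by (simp add: lin)
      also have "\<dots> \<le> e * norm w * norm w"
        using small[OF t] e by (intro mult_right_mono mult_left_mono) auto
      finally have "norm (D (z + t *\<^sub>R w) w - D z w - t *\<^sub>R B w w) \<le> e * (norm w)\<^sup>2"
        by (simp add: power2_eq_square mult.assoc)
      then show "onorm (\<lambda>s. s *\<^sub>R (D (z + t *\<^sub>R w) w - D z w - t *\<^sub>R B w w)) \<le> e * (norm w)\<^sup>2"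
        by (simp add: onorm_scaleR_left onorm_id)
    qed auto
    then show ?thesis by (simp add: \<phi>_def algebra_simps)
  qed
  then show "\<forall>\<^sub>F w in nhds 0. norm (F (z + w) - F z - D z w - (1/2) *\<^sub>R B w w) \<le> e * (norm w)\<^sup>2"
    unfolding eventually_nhds_metric dist_norm using d1(1) d2(1)
    by (intro exI[of _ "min d1 d2"]) auto
qed

lemma real_taylor2:
  fixes \<Phi> \<Phi>' :: "real \<Rightarrow> real"
  assumes "\<forall>\<^sub>F v in nhds N. (\<Phi> has_real_derivative \<Phi>' v) (at v)"
    and "(\<Phi>' has_real_derivative c) (at N)"
  shows "upper_o2 (\<lambda>h. \<bar>\<Phi> (N + h) - \<Phi> N - \<Phi>' N * h - c / 2 * h\<^sup>2\<bar>)"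
proof -
  have "upper_o2 (\<lambda>h. norm (\<Phi> (N + h) - \<Phi> N - (\<Phi>' N * h) - (1/2) *\<^sub>R (c * h * h)))"
  proof (rule second_order_taylor[where D = "\<lambda>v h. \<Phi>' v * h" and B = "\<lambda>h w. c * h * w"])
    show "\<forall>\<^sub>F v in nhds N. (\<Phi> has_derivative (*) (\<Phi>' v)) (at v)"
      using assms(1) by (simp add: has_field_derivative_def)
    fix e :: real assume e: "e > 0"
    obtain d where d: "d > 0"
      "\<And>y. norm (y - N) < d \<Longrightarrow> norm (\<Phi>' y - \<Phi>' N - c * (y - N)) \<le> e * norm (y - N)"
      using assms(2) e unfolding has_field_derivative_def has_derivative_at_alt by blast
    have "norm (\<Phi>' (N + h) * w - \<Phi>' N * w - c * h * w) \<le> e * norm h * norm w"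
      if "norm h < d" for h w
    proof -
      have "norm (\<Phi>' (N + h) * w - \<Phi>' N * w - c * h * w)
        = norm (\<Phi>' (N + h) - \<Phi>' N - c * h) * norm w"
        by (simp only: norm_mult[symmetric]) (simp add: algebra_simps)
      also have "\<dots> \<le> e * norm h * norm w"
        using d(2)[of "N + h"] that by (intro mult_right_mono) auto
      finally show ?thesis .
    qed
    then show "\<forall>\<^sub>F h in nhds 0. \<forall>w. norm (\<Phi>' (N + h) * w - \<Phi>' N * w - c * h * w) \<le> e * norm h * norm w"
      unfolding eventually_nhds_metric dist_norm using d(1) by (intro exI[of _ d]) auto
  qed simp
  then show ?thesis by (simp add: power2_eq_square mult.assoc)
qed

section \<open>Expansions of maps given by their partial derivatives\<close>

lemma has_derivative_partials:
  assumes "C1_map_on f D" "z \<in> D"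
  shows "(f has_derivative (\<lambda>w. Re w *\<^sub>R partial_x f z + Im w *\<^sub>R partial_y f z)) (at z)"
proof -
  have D: "(f has_derivative frechet_derivative f (at z)) (at z)"
    using assms by (auto simp: C1_map_on_def frechet_derivative_works)
  then have l: "linear (frechet_derivative f (at z))" by (rule has_derivative_linear)
  have "frechet_derivative f (at z) w = Re w *\<^sub>R partial_x f z + Im w *\<^sub>R partial_y f z" for w
  proof -
    have "w = Re w *\<^sub>R 1 + Im w *\<^sub>R \<i>" by (simp add: complex_eq_iff)
    then show ?thesis
      unfolding partial_x_def partial_y_def
      by (metis linear_add[OF l] linear_scale[OF l])
  qed
  then have "frechet_derivative f (at z) = (\<lambda>w. Re w *\<^sub>R partial_x f z + Im w *\<^sub>R partial_y f z)" ..
  with D show ?thesis by simp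
qed

lemma C1_map_on_subset: "C1_map_on f D \<Longrightarrow> D' \<subseteq> D \<Longrightarrow> C1_map_on f D'"
  by (auto simp: C1_map_on_def intro: continuous_on_subset)

lemma conformal_map_on_subset: "conformal_map_on f D \<Longrightarrow> D' \<subseteq> D \<Longrightarrow> conformal_map_on f D'"
  by (auto simp: conformal_map_on_def intro: C1_map_on_subset)

lemma harmonic_map_on_subset: "harmonic_map_on f D \<Longrightarrow> D' \<subseteq> D \<Longrightarrow> harmonic_map_on f D'"
  by (auto simp: harmonic_map_on_def C2_map_on_def intro: C1_map_on_subset)

lemma C1_map_on_continuous_on: "C1_map_on f D \<Longrightarrow> continuous_on D f"
  by (auto simp: C1_map_on_def differentiable_imp_continuous_within
      intro!: continuous_at_imp_continuous_on)

text \<open>The mixed coefficient \<open>b\<close> stays existential because the trace does not see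
  it; the symmetry of the mixed partial derivatives is thereby avoided.\<close>

lemma C2_taylor:
  assumes "open D" "z \<in> D" "C2_map_on f D"
  shows "\<exists>b. upper_o2 (\<lambda>w. norm (f (z + w) - f z - quad (partial_x f z) (partial_y f z)
      ((1/2) *\<^sub>R partial_x (partial_x f) z) b ((1/2) *\<^sub>R partial_y (partial_y f) z) w))"
proof -
  let ?fx = "partial_x f" and ?fy = "partial_y f"
  have C: "C1_map_on f D" "C1_map_on ?fx D" "C1_map_on ?fy D"
    using assms(3) by (auto simp: C2_map_on_def)
  define B where "B = (\<lambda>h w. Re w *\<^sub>R (Re h *\<^sub>R partial_x ?fx z + Im h *\<^sub>R partial_y ?fx z)
      + Im w *\<^sub>R (Re h *\<^sub>R partial_x ?fy z + Im h *\<^sub>R partial_y ?fy z))"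
  have "upper_o2 (\<lambda>w. norm (f (z + w) - f z - (Re w *\<^sub>R ?fx z + Im w *\<^sub>R ?fy z) - (1/2) *\<^sub>R B w w))"
  proof (rule second_order_taylor[where D = "\<lambda>v w. Re w *\<^sub>R ?fx v + Im w *\<^sub>R ?fy v"
        and B = B])
    show "\<forall>\<^sub>F x in nhds z. (f has_derivative (\<lambda>w. Re w *\<^sub>R ?fx x + Im w *\<^sub>R ?fy x)) (at x)"
      using eventually_nhds_in_open[OF assms(1,2)]
      by eventually_elim (rule has_derivative_partials[OF C(1)])
    show "B (t *\<^sub>R w) w = t *\<^sub>R B w w" for t w by (simp add: B_def algebra_simps)
    fix e :: real assume "e > 0"
    then have e: "e / 2 > 0" by simp
    obtain d1 where d1: "d1 > 0" "\<And>y. norm (y - z) < d1 \<Longrightarrow> norm (?fx y - ?fx z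
        - (Re (y - z) *\<^sub>R partial_x ?fx z + Im (y - z) *\<^sub>R partial_y ?fx z)) \<le> e/2 * norm (y - z)"
      using has_derivative_partials[OF C(2) assms(2)] e unfolding has_derivative_at_alt by blast
    obtain d2 where d2: "d2 > 0" "\<And>y. norm (y - z) < d2 \<Longrightarrow> norm (?fy y - ?fy z
        - (Re (y - z) *\<^sub>R partial_x ?fy z + Im (y - z) *\<^sub>R partial_y ?fy z)) \<le> e/2 * norm (y - z)"
      using has_derivative_partials[OF C(3) assms(2)] e unfolding has_derivative_at_alt by blast
    have "norm (Re w *\<^sub>R ?fx (z + h) + Im w *\<^sub>R ?fy (z + h) - (Re w *\<^sub>R ?fx z + Im w *\<^sub>R ?fy z) - B h w)
        \<le> e * norm h * norm w" if h: "norm h < min d1 d2" for h w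
    proof -
      let ?a = "?fx (z + h) - ?fx z - (Re h *\<^sub>R partial_x ?fx z + Im h *\<^sub>R partial_y ?fx z)"
      let ?b = "?fy (z + h) - ?fy z - (Re h *\<^sub>R partial_x ?fy z + Im h *\<^sub>R partial_y ?fy z)"
      have "norm (Re w *\<^sub>R ?fx (z + h) + Im w *\<^sub>R ?fy (z + h) - (Re w *\<^sub>R ?fx z + Im w *\<^sub>R ?fy z) - B h w)
          = norm (Re w *\<^sub>R ?a + Im w *\<^sub>R ?b)"
        by (rule arg_cong[of _ _ norm]) (simp add: B_def algebra_simps)
      also have "\<dots> \<le> \<bar>Re w\<bar> * norm ?a + \<bar>Im w\<bar> * norm ?b"
        by (rule order_trans[OF norm_triangle_ineq]) simp
      also have "\<dots> \<le> norm w * (e/2 * norm h) + norm w * (e/2 * norm h)"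
        using d1(2)[of "z + h"] d2(2)[of "z + h"] h e
        by (intro add_mono mult_mono abs_Re_le_cmod abs_Im_le_cmod) auto
      finally show ?thesis by (simp add: algebra_simps)
    qed
    then show "\<forall>\<^sub>F h in nhds 0. \<forall>w. norm (Re w *\<^sub>R ?fx (z + h) + Im w *\<^sub>R ?fy (z + h)
        - (Re w *\<^sub>R ?fx z + Im w *\<^sub>R ?fy z) - B h w) \<le> e * norm h * norm w"
      unfolding eventually_nhds_metric dist_norm using d1(1) d2(1)
      by (intro exI[of _ "min d1 d2"]) auto
  qed
  moreover have "f (z + w) - f z - (Re w *\<^sub>R ?fx z + Im w *\<^sub>R ?fy z) - (1/2) *\<^sub>R B w w
    = f (z + w) - f z - quad (?fx z) (?fy z) ((1/2) *\<^sub>R partial_x ?fx z)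
        ((1/2) *\<^sub>R (partial_y ?fx z + partial_x ?fy z)) ((1/2) *\<^sub>R partial_y ?fy z) w" for w
    by (simp add: B_def quad_def algebra_simps power2_eq_square)
  ultimately show ?thesis by auto
qed

text \<open>The inner increment has the form taken by a squared distance along a conformal plane.
  Two errors arise: the remainder of \<open>\<Phi>\<close>, and the gap between the square of the
  increment and the square of its linear part, which is cubic in \<open>w\<close>.\<close>

lemma upper_o2_compose_quadratic:
  fixes \<Phi> :: "real \<Rightarrow> real"
  assumes "upper_o2 (\<lambda>h. \<bar>\<Phi> (N + h) - \<Phi> N - p1 * h - p2 / 2 * h\<^sup>2\<bar>)"
  shows "upper_o2 (\<lambda>w. \<bar>\<Phi> (N + (Re w * \<alpha> + Im w * \<beta> + \<mu> * (norm w)\<^sup>2)) - \<Phi> N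
    - quad (p1 * \<alpha>) (p1 * \<beta>) (p1 * \<mu> + p2 / 2 * \<alpha>\<^sup>2) (p2 * \<alpha> * \<beta>) (p1 * \<mu> + p2 / 2 * \<beta>\<^sup>2) w\<bar>)"
proof -
  define n where "n = (\<lambda>w. Re w * \<alpha> + Im w * \<beta> + \<mu> * (norm w)\<^sup>2)"
  define C where "C = \<bar>\<alpha>\<bar> + \<bar>\<beta>\<bar> + \<bar>\<mu>\<bar>"
  have lin: "\<bar>Re w * \<alpha> + Im w * \<beta>\<bar> \<le> C * norm w" for w
  proof -
    have "\<bar>Re w * \<alpha> + Im w * \<beta>\<bar> \<le> \<bar>Re w\<bar> * \<bar>\<alpha>\<bar> + \<bar>Im w\<bar> * \<bar>\<beta>\<bar>"
      by (rule order_trans[OF abs_triangle_ineq]) (simp add: abs_mult)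
    also have "\<dots> \<le> norm w * \<bar>\<alpha>\<bar> + norm w * \<bar>\<beta>\<bar>"
      by (intro add_mono mult_right_mono abs_Re_le_cmod abs_Im_le_cmod) auto
    also have "\<dots> \<le> C * norm w" by (simp add: C_def algebra_simps)
    finally show ?thesis .
  qed
  have nb: "\<bar>n w\<bar> \<le> 2 * C * norm w" if "norm w < 1" for w
  proof -
    have "\<bar>n w\<bar> \<le> \<bar>Re w * \<alpha> + Im w * \<beta>\<bar> + \<bar>\<mu>\<bar> * (norm w)\<^sup>2"
      unfolding n_def by (rule order_trans[OF abs_triangle_ineq]) (simp add: abs_mult)
    moreover have "\<bar>\<mu>\<bar> * (norm w)\<^sup>2 \<le> C * norm w"
      using that by (intro mult_mono) (auto simp: C_def power2_eq_square mult_left_le)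
    ultimately show ?thesis using lin[of w] by simp
  qed
  have C0: "C \<ge> 0" by (simp add: C_def)
  have 1: "upper_o2 (\<lambda>w. \<bar>\<Phi> (N + n w) - \<Phi> N - p1 * n w - p2 / 2 * (n w)\<^sup>2\<bar>)"
    unfolding upper_o2_def
  proof (intro allI impI)
    fix e :: real assume e: "e > 0"
    \<comment> \<open>The increment is at most \<open>2 * C * norm w\<close>, so squaring it costs
      the factor \<open>4 * C\<^sup>2\<close>; the summand \<open>1\<close> covers
      \<open>C = 0\<close>.\<close>
    define e' where "e' = e / (4 * C\<^sup>2 + 1)"
    have e': "e' > 0" "e' * (4 * C\<^sup>2) \<le> e"
      using e by (auto simp: e'_def field_simps add_pos_nonneg)
    obtain d where d: "d > 0"
      "\<And>h. norm h < d \<Longrightarrow> \<bar>\<Phi> (N + h) - \<Phi> N - p1 * h - p2 / 2 * h\<^sup>2\<bar> \<le> e' * (norm h)\<^sup>2"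
      using assms e'(1) unfolding upper_o2_def eventually_nhds_metric dist_norm by fastforce
    have "d / (2 * C + 1) > 0" using d C0 by simp
    from eventually_norm_less[OF this] eventually_norm_less[OF zero_less_one]
    show "\<forall>\<^sub>F w in nhds 0. \<bar>\<Phi> (N + n w) - \<Phi> N - p1 * n w - p2 / 2 * (n w)\<^sup>2\<bar> \<le> e * (norm w)\<^sup>2"
    proof eventually_elim
      case w: (elim w)
      have "\<bar>n w\<bar> \<le> (2 * C + 1) * norm w" using nb[OF w(2)] norm_ge_zero[of w] unfolding distrib_right by linarith
      also have "\<dots> < d" using w(1) C0 by (simp add: field_simps)
      finally have "\<bar>\<Phi> (N + n w) - \<Phi> N - p1 * n w - p2 / 2 * (n w)\<^sup>2\<bar> \<le> e' * (n w)\<^sup>2"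
        using d(2)[of "n w"] by simp
      also have "(n w)\<^sup>2 \<le> (2 * C * norm w)\<^sup>2" using nb[OF w(2)] by (simp add: abs_le_square_iff[symmetric])
      then have "e' * (n w)\<^sup>2 \<le> e' * (4 * C\<^sup>2) * (norm w)\<^sup>2"
        using e'(1) by (simp add: power_mult_distrib)
      also have "\<dots> \<le> e * (norm w)\<^sup>2" using e'(2) by (intro mult_right_mono) auto
      finally show "\<bar>\<Phi> (N + n w) - \<Phi> N - p1 * n w - p2 / 2 * (n w)\<^sup>2\<bar> \<le> e * (norm w)\<^sup>2" .
    qed
  qed
  have 2: "upper_o2 (\<lambda>w. \<bar>p2 / 2 * (\<mu> * (norm w)\<^sup>2) * ((Re w * \<alpha> + Im w * \<beta>) + n w)\<bar>)"
  proof (rule upper_o2_cube)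
    from eventually_norm_less[OF zero_less_one]
    show "\<forall>\<^sub>F w in nhds 0. \<bar>p2 / 2 * (\<mu> * (norm w)\<^sup>2) * ((Re w * \<alpha> + Im w * \<beta>) + n w)\<bar>
       \<le> (\<bar>p2 / 2 * \<mu>\<bar> * (3 * C)) * norm w ^ 3"
    proof eventually_elim
      case (elim w)
      have "\<bar>(Re w * \<alpha> + Im w * \<beta>) + n w\<bar> \<le> 3 * C * norm w"
        using lin[of w] nb[of w] elim by (simp add: abs_le_iff)
      then have "\<bar>p2 / 2 * \<mu>\<bar> * (norm w)\<^sup>2 * \<bar>(Re w * \<alpha> + Im w * \<beta>) + n w\<bar>
          \<le> \<bar>p2 / 2 * \<mu>\<bar> * (norm w)\<^sup>2 * (3 * C * norm w)"
        by (intro mult_left_mono) auto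
      then show ?case by (simp add: abs_mult power3_eq_cube power2_eq_square mult_ac)
    qed
  qed
  have "\<Phi> (N + n w) - \<Phi> N
    - quad (p1 * \<alpha>) (p1 * \<beta>) (p1 * \<mu> + p2 / 2 * \<alpha>\<^sup>2) (p2 * \<alpha> * \<beta>) (p1 * \<mu> + p2 / 2 * \<beta>\<^sup>2) w
    = (\<Phi> (N + n w) - \<Phi> N - p1 * n w - p2 / 2 * (n w)\<^sup>2)
      + p2 / 2 * (\<mu> * (norm w)\<^sup>2) * ((Re w * \<alpha> + Im w * \<beta>) + n w)" for w
    unfolding quad_def n_def cmod_power2 by (simp add: field_simps power2_eq_square)
  then have "upper_o2 (\<lambda>w. \<bar>\<Phi> (N + n w) - \<Phi> N
    - quad (p1 * \<alpha>) (p1 * \<beta>) (p1 * \<mu> + p2 / 2 * \<alpha>\<^sup>2) (p2 * \<alpha> * \<beta>) (p1 * \<mu> + p2 / 2 * \<beta>\<^sup>2) w\<bar>)"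
    by (intro upper_o2_mono[OF upper_o2_add[OF 1 2]] always_eventually allI)
      (metis abs_triangle_ineq)
  then show ?thesis by (simp only: n_def)
qed

section \<open>Viscosity minimal plurisubharmonicity\<close>

text \<open>The vectors \<open>e1\<close>, \<open>e2\<close> may both vanish, as the tangent vectors
  do at a branch point of a disc; the condition is then automatic.\<close>

definition viscosity_MPSH_at :: "('a::euclidean_space \<Rightarrow> real) \<Rightarrow> 'a \<Rightarrow> bool" where
  "viscosity_MPSH_at h y \<longleftrightarrow> (\<forall>e1 e2 l1 l2 a b c. norm e1 = norm e2 \<and> e1 \<bullet> e2 = 0 \<and>
     upper_o2 (\<lambda>w. h (y + Re w *\<^sub>R e1 + Im w *\<^sub>R e2) - h y - quad l1 l2 a b c w) \<longrightarrow> a + c \<ge> 0)"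

text \<open>Stronger than the viscosity condition. A jet from below can be moved to the other side
  of a contact inequality, so a summand of this kind is added to a viscosity function without any
  regularization.\<close>

definition lower_jet_MPSH_at :: "('a::euclidean_space \<Rightarrow> real) \<Rightarrow> 'a \<Rightarrow> bool" where
  "lower_jet_MPSH_at F y \<longleftrightarrow> (\<forall>e1 e2. norm e1 = norm e2 \<and> e1 \<bullet> e2 = 0 \<longrightarrow>
     (\<exists>l1 l2 a b c. a + c \<ge> 0 \<and>
        upper_o2 (\<lambda>w. F y + quad l1 l2 a b c w - F (y + Re w *\<^sub>R e1 + Im w *\<^sub>R e2))))"

lemma eventually_plane:
  fixes y e1 e2 :: "'a::real_normed_vector"
  assumes "\<forall>\<^sub>F x in nhds y. P x"
  shows "\<forall>\<^sub>F w in nhds 0. P (y + Re w *\<^sub>R e1 + Im w *\<^sub>R e2)"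
proof -
  have id: "((\<lambda>w. w) \<longlongrightarrow> 0) (nhds (0::complex))" by (rule filterlim_ident)
  have "((\<lambda>w. y + Re w *\<^sub>R e1 + Im w *\<^sub>R e2) \<longlongrightarrow> y + Re 0 *\<^sub>R e1 + Im 0 *\<^sub>R e2) (nhds 0)"
    by (intro tendsto_intros id)
  then show ?thesis using assms by (auto simp: filterlim_iff)
qed

lemma quad_minus:
  "quad l1 l2 a b c w - quad l1' l2' a' b' c' w = quad (l1-l1') (l2-l2') (a-a') (b-b') (c-c') w"
  by (simp add: quad_def algebra_simps)

lemma viscosity_MPSH_add:
  assumes u: "viscosity_MPSH_at u y" and F: "lower_jet_MPSH_at F y"
    and h: "\<forall>\<^sub>F x in nhds y. h x = u x + F x"
  shows "viscosity_MPSH_at h y"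
  unfolding viscosity_MPSH_at_def
proof (intro allI impI, elim conjE)
  fix e1 e2 l1 l2 a b c
  assume e: "norm e1 = norm e2" "e1 \<bullet> e2 = 0"
    and up: "upper_o2 (\<lambda>w. h (y + Re w *\<^sub>R e1 + Im w *\<^sub>R e2) - h y - quad l1 l2 a b c w)"
  obtain l1' l2' a' b' c' where F': "a' + c' \<ge> 0"
    "upper_o2 (\<lambda>w. F y + quad l1' l2' a' b' c' w - F (y + Re w *\<^sub>R e1 + Im w *\<^sub>R e2))"
    using F e unfolding lower_jet_MPSH_at_def by blast
  have "upper_o2 (\<lambda>w. u (y + Re w *\<^sub>R e1 + Im w *\<^sub>R e2) - u y
      - quad (l1-l1') (l2-l2') (a-a') (b-b') (c-c') w)"
  proof (rule upper_o2_mono[OF upper_o2_add[OF up F'(2)]])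
    have "h y = u y + F y" using h by (rule eventually_nhds_x_imp_x)
    with eventually_plane[OF h, of e1 e2]
    show "\<forall>\<^sub>F w in nhds 0. u (y + Re w *\<^sub>R e1 + Im w *\<^sub>R e2) - u y
        - quad (l1-l1') (l2-l2') (a-a') (b-b') (c-c') w
        \<le> h (y + Re w *\<^sub>R e1 + Im w *\<^sub>R e2) - h y - quad l1 l2 a b c w
          + (F y + quad l1' l2' a' b' c' w - F (y + Re w *\<^sub>R e1 + Im w *\<^sub>R e2))"
      by (elim eventually_mono) (simp add: quad_minus[symmetric])
  qed
  then have "(a - a') + (c - c') \<ge> 0" using u e unfolding viscosity_MPSH_at_def by blast
  then show "a + c \<ge> 0" using F'(1) by simp
qed

text \<open>At a minimum a touching quadratic is nonnegative up to second order. This takes the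
  place of a general statement on maxima when the barrier is glued to a constant.\<close>

lemma viscosity_MPSH_local_min:
  assumes "\<forall>\<^sub>F x in nhds y. h y \<le> h x"
  shows "viscosity_MPSH_at h y"
  unfolding viscosity_MPSH_at_def
proof (intro allI impI, elim conjE)
  fix e1 e2 l1 l2 a b c
  assume up: "upper_o2 (\<lambda>w. h (y + Re w *\<^sub>R e1 + Im w *\<^sub>R e2) - h y - quad l1 l2 a b c w)"
  show "a + c \<ge> 0"
  proof (rule upper_o2_quad_trace_nonneg[OF upper_o2_mono[OF up]])
    show "\<forall>\<^sub>F w in nhds 0. - quad l1 l2 a b c w
        \<le> h (y + Re w *\<^sub>R e1 + Im w *\<^sub>R e2) - h y - quad l1 l2 a b c w"
      using eventually_plane[OF assms, of e1 e2] by eventually_elim simp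
  qed
qed

section \<open>From the submean value inequality to second-order contact\<close>

lemma ennreal_integral_le_nn_integral:
  fixes f :: "'a \<Rightarrow> real"
  assumes "integrable M f"
  shows "ennreal (integral\<^sup>L M f) \<le> (\<integral>\<^sup>+x. ennreal (f x) \<partial>M)"
proof -
  have fin: "(\<integral>\<^sup>+x. ennreal (f x) \<partial>M) \<noteq> \<infinity>" using assms by (simp add: real_integrable_def)
  have "integral\<^sup>L M f \<le> enn2real (\<integral>\<^sup>+x. ennreal (f x) \<partial>M)"
    using real_lebesgue_integral_def[OF assms] by simp
  then have "ennreal (integral\<^sup>L M f) \<le> ennreal (enn2real (\<integral>\<^sup>+x. ennreal (f x) \<partial>M))"
    by (rule ennreal_leI)
  also have "\<dots> = (\<integral>\<^sup>+x. ennreal (f x) \<partial>M)"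
    using fin by (simp add: ennreal_enn2real less_top)
  finally show ?thesis .
qed

text \<open>\<open>F\<close> is an explicit primitive; over a full period only the constant and the
  trace survive.\<close>

lemma has_bochner_integral_quad_circle:
  "has_bochner_integral lborel
     (\<lambda>t. (k - quad l1 l2 a b c (of_real r * cis t)) * indicator {0..2 * pi} t)
     (2 * pi * k - r\<^sup>2 * pi * (a + c))"
proof -
  define F where "F = (\<lambda>t. k * t - r * (l1 * sin t - l2 * cos t)
      - r\<^sup>2 * (a * (t / 2 + sin t * cos t / 2) + b * (sin t)\<^sup>2 / 2 + c * (t / 2 - sin t * cos t / 2)))"
  have "has_bochner_integral lborel
     (\<lambda>t. (k - quad l1 l2 a b c (of_real r * cis t)) * indicator {0..2 * pi} t) (F (2 * pi) - F 0)"
  proof (rule has_bochner_integral_FTC_Icc_real)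
    fix t :: real
    have s: "(sin t)\<^sup>2 = 1 - (cos t)\<^sup>2" using sin_squared_eq .
    have "(F has_real_derivative (k - r * (l1 * cos t + l2 * sin t)
       - r\<^sup>2 * (a * (1/2 + (cos t * cos t - sin t * sin t)/2) + b * (sin t * cos t)
          + c * (1/2 - (cos t * cos t - sin t * sin t)/2)))) (at t)"
      unfolding F_def by (auto intro!: derivative_eq_intros simp: field_simps)
    also have "(k - r * (l1 * cos t + l2 * sin t)
       - r\<^sup>2 * (a * (1/2 + (cos t * cos t - sin t * sin t)/2) + b * (sin t * cos t)
          + c * (1/2 - (cos t * cos t - sin t * sin t)/2)))
      = k - quad l1 l2 a b c (of_real r * cis t)"
      using s unfolding quad_def by (simp add: power_mult_distrib) algebra
    finally show "(F has_real_derivative k - quad l1 l2 a b c (of_real r * cis t)) (at t)" .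
    show "isCont (\<lambda>t. k - quad l1 l2 a b c (of_real r * cis t)) t"
      unfolding quad_def by (simp add: continuous_intros)
  qed simp
  moreover have "F (2 * pi) - F 0 = 2 * pi * k - r\<^sup>2 * pi * (a + c)"
    by (simp add: F_def field_simps)
  ultimately show ?thesis by simp
qed

lemma aff_dim_conformal_plane:
  fixes y e1 e2 :: "'a::euclidean_space"
  assumes "e1 \<noteq> 0" "norm e1 = norm e2" "e1 \<bullet> e2 = 0"
  defines "L \<equiv> range (\<lambda>z. y + Re z *\<^sub>R e1 + Im z *\<^sub>R e2)"
  shows "affine L \<and> aff_dim L = 2"
proof -
  have "e2 \<noteq> 0" "e1 \<noteq> e2" using assms by auto
  have ind: "independent {e1, e2}"
    by (rule pairwise_orthogonal_independent)
      (use assms(1,3) \<open>e2 \<noteq> 0\<close> in \<open>auto simp: pairwise_def orthogonal_def inner_commute\<close>)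
  have "L = (+) y ` span {e1, e2}"
  proof (intro equalityI subsetI)
    fix v assume "v \<in> L"
    then obtain z where "v = y + (Re z *\<^sub>R e1 + Im z *\<^sub>R e2)" by (auto simp: L_def add.assoc)
    moreover have "Re z *\<^sub>R e1 + Im z *\<^sub>R e2 \<in> span {e1, e2}"
      by (intro span_add span_scale span_base) auto
    ultimately show "v \<in> (+) y ` span {e1, e2}" by blast
  next
    fix v assume "v \<in> (+) y ` span {e1, e2}"
    then obtain s where s: "s \<in> span {e1, e2}" "v = y + s" by auto
    then obtain p q where "s = p *\<^sub>R e1 + q *\<^sub>R e2"
      by (auto simp: span_insert algebra_simps)
    then have "v = y + Re (Complex p q) *\<^sub>R e1 + Im (Complex p q) *\<^sub>R e2" using s by simp
    then show "v \<in> L" unfolding L_def by blast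
  qed
  moreover have "dim (span {e1, e2}) = 2"
    using ind \<open>e1 \<noteq> e2\<close> by (simp add: dim_eq_card_independent)
  ultimately show ?thesis
    by (simp add: affine_translation[symmetric] subspace_imp_affine aff_dim_translation_eq aff_dim_subspace)
qed

text \<open>A contact quadratic with negative trace would push the mean over a small circle below
  the value at the centre. As \<open>u\<close> is nonpositive, the mean is minus one nonnegative
  integral, and this is bounded by an explicit integrable minorant, so measurability of
  \<open>u\<close> never has to be discussed.\<close>

lemma MPSH_imp_viscosity_MPSH:
  fixes u :: "'a::euclidean_space \<Rightarrow> real"
  assumes M: "MPSH_on G (\<lambda>x. ereal (u x))" and neg: "\<And>x. x \<in> G \<Longrightarrow> u x \<le> 0" and y: "y \<in> G"
  shows "viscosity_MPSH_at u y"
  unfolding viscosity_MPSH_at_def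
proof (intro allI impI, elim conjE)
  fix e1 e2 l1 l2 a b c
  assume e: "norm e1 = norm e2" "e1 \<bullet> e2 = 0"
    and up: "upper_o2 (\<lambda>w. u (y + Re w *\<^sub>R e1 + Im w *\<^sub>R e2) - u y - quad l1 l2 a b c w)"
  show "a + c \<ge> 0"
  proof (cases "e1 = 0")
    case True
    then have "e2 = 0" using e by simp
    with True up have "upper_o2 (\<lambda>w. - quad l1 l2 a b c w)" by simp
    then show ?thesis by (rule upper_o2_quad_trace_nonneg)
  next
    case False
    define \<phi> where "\<phi> = (\<lambda>z. y + Re z *\<^sub>R e1 + Im z *\<^sub>R e2)"
    have "conformal_linear_coords (range \<phi>) \<phi>"
      unfolding conformal_linear_coords_def \<phi>_def using False e by blast
    with aff_dim_conformal_plane[OF False e, of y, folded \<phi>_def] M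
    have sub: "subharmonic_on (\<phi> -` G) ((\<lambda>x. ereal (u x)) \<circ> \<phi>)" unfolding MPSH_on_def by blast
    show ?thesis
    proof (rule ccontr)
      assume neg': "\<not> a + c \<ge> 0"
      \<comment> \<open>The circle mean of the contact quadratic is
        \<open>- 2 * \<epsilon> * r\<^sup>2\<close>; the contact error uses up half of it and
        \<open>- \<epsilon> * r\<^sup>2\<close> remains.\<close>
      define \<epsilon> where "\<epsilon> = - (a + c) / 4"
      have \<epsilon>: "\<epsilon> > 0" using neg' by (simp add: \<epsilon>_def)
      obtain d where d: "d > 0"
        "\<And>w. norm w < d \<Longrightarrow> u (\<phi> w) - u y - quad l1 l2 a b c w \<le> \<epsilon> * (norm w)\<^sup>2"
        using up \<epsilon> unfolding upper_o2_def eventually_nhds_metric dist_norm \<phi>_def by fastforce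
      have "open (\<phi> -` G)" "0 \<in> \<phi> -` G" using sub y by (auto simp: subharmonic_on_def \<phi>_def)
      then obtain r0 where r0: "r0 > 0" "cball 0 r0 \<subseteq> \<phi> -` G" using open_contains_cball by blast
      define r where "r = min r0 (d / 2)"
      have r: "r > 0" "r < d" "cball 0 r \<subseteq> \<phi> -` G" using r0 d(1) by (auto simp: r_def)
      define w where "w = (\<lambda>t. of_real r * cis t)"
      have nw: "norm (w t) = r" for t using r(1) by (simp add: w_def norm_mult)
      then have G: "\<phi> (w t) \<in> G" for t using r(3) by (auto simp: subset_iff)
      have "ereal (u y) \<le> circle_mean ((\<lambda>x. ereal (u x)) \<circ> \<phi>) 0 r"
      proof -
        have "((\<lambda>x. ereal (u x)) \<circ> \<phi>) 0 \<le> circle_mean ((\<lambda>x. ereal (u x)) \<circ> \<phi>) 0 r"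
          using sub r unfolding subharmonic_on_def by blast
        then show ?thesis by (simp add: \<phi>_def)
      qed
      also have "\<dots> = - enn2ereal (\<integral>\<^sup>+t\<in>{0..2*pi}. ennreal (- u (\<phi> (w t))) \<partial>lborel) / ereal (2 * pi)"
      proof -
        have "(\<integral>\<^sup>+t\<in>{0..2*pi}. e2ennreal (ereal (u (\<phi> (w t)))) \<partial>lborel) = 0"
          using neg[OF G] by (simp add: ennreal_neg)
        then show ?thesis
          unfolding circle_mean_def by (simp add: w_def zero_ennreal.rep_eq)
      qed
      finally have mean: "ereal (u y) \<le> \<dots>" .
      define k where "k = - (u y + \<epsilon> * r\<^sup>2)"
      define J where "J = 2 * pi * k - r\<^sup>2 * pi * (a + c)"
      have J: "J = 2 * pi * (- u y + \<epsilon> * r\<^sup>2)" by (simp add: J_def k_def \<epsilon>_def field_simps)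
      have "has_bochner_integral lborel
          (\<lambda>t. (k - quad l1 l2 a b c (w t)) * indicator {0..2 * pi} t) J"
        unfolding w_def J_def by (rule has_bochner_integral_quad_circle)
      then have "ennreal J \<le> (\<integral>\<^sup>+t. ennreal ((k - quad l1 l2 a b c (w t)) * indicator {0..2 * pi} t) \<partial>lborel)"
        by (metis ennreal_integral_le_nn_integral has_bochner_integral_iff)
      also have "\<dots> \<le> (\<integral>\<^sup>+t\<in>{0..2*pi}. ennreal (- u (\<phi> (w t))) \<partial>lborel)"
      proof (rule nn_integral_mono)
        fix t :: real
        have "k - quad l1 l2 a b c (w t) \<le> - u (\<phi> (w t))"
          using d(2)[of "w t"] r(2) by (simp add: nw k_def)
        then show "ennreal ((k - quad l1 l2 a b c (w t)) * indicator {0..2 * pi} t)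
            \<le> ennreal (- u (\<phi> (w t))) * indicator {0..2*pi} t"
          by (auto simp: indicator_def intro: ennreal_leI)
      qed
      finally have "enn2ereal (ennreal J)
          \<le> enn2ereal (\<integral>\<^sup>+t\<in>{0..2*pi}. ennreal (- u (\<phi> (w t))) \<partial>lborel)"
        by (simp add: less_eq_ennreal.rep_eq)
      moreover have "ereal J \<le> enn2ereal (ennreal J)" by (cases "J \<ge> 0") (auto simp: ennreal_neg zero_ennreal.rep_eq)
      ultimately have "ereal J \<le> enn2ereal (\<integral>\<^sup>+t\<in>{0..2*pi}. ennreal (- u (\<phi> (w t))) \<partial>lborel)"
        by (rule order_trans[rotated])
      then have "- enn2ereal (\<integral>\<^sup>+t\<in>{0..2*pi}. ennreal (- u (\<phi> (w t))) \<partial>lborel) / ereal (2 * pi)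
          \<le> - ereal J / ereal (2 * pi)"
        by (intro ereal_divide_right_mono, simp only: ereal_minus_le_minus) simp
      with mean have "ereal (u y) \<le> - ereal J / ereal (2 * pi)" by (rule order_trans)
      then have "u y \<le> - J / (2 * pi)" by simp
      then have "pi * (\<epsilon> * r\<^sup>2) \<le> 0" unfolding J by (simp add: field_simps)
      moreover have "pi * (\<epsilon> * r\<^sup>2) > 0" using \<epsilon> r(1) by simp
      ultimately show False by simp
    qed
  qed
qed

section \<open>Composition with conformal harmonic maps\<close>

lemma quad_bound:
  fixes a b c :: "'b::real_normed_vector"
  shows "norm (quad 0 0 a b c w) \<le> (norm a + norm b + norm c) * (norm w)\<^sup>2"
proof -
  have "norm (quad 0 0 a b c w) \<le> norm ((Re w)\<^sup>2 *\<^sub>R a) + norm ((Re w * Im w) *\<^sub>R b) + norm ((Im w)\<^sup>2 *\<^sub>R c)"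
    unfolding quad_def by (simp add: norm_triangle_le add.assoc)
  also have "\<dots> \<le> (norm w)\<^sup>2 * norm a + (norm w)\<^sup>2 * norm b + (norm w)\<^sup>2 * norm c"
  proof -
    have "(Re w)\<^sup>2 \<le> (norm w)\<^sup>2" "(Im w)\<^sup>2 \<le> (norm w)\<^sup>2" by (simp_all add: cmod_power2)
    moreover have "\<bar>Re w * Im w\<bar> \<le> (norm w)\<^sup>2"
      unfolding abs_mult power2_eq_square
      by (intro mult_mono abs_Re_le_cmod abs_Im_le_cmod) auto
    ultimately show ?thesis by (simp only: norm_scaleR abs_power2) (intro add_mono mult_right_mono; simp)
  qed
  finally show ?thesis by (simp add: algebra_simps)
qed

lemma inner_quad: "x \<bullet> quad l1 l2 a b c w = quad (x \<bullet> l1) (x \<bullet> l2) (x \<bullet> a) (x \<bullet> b) (x \<bullet> c) w"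
  by (simp add: quad_def inner_add_right)

text \<open>Doubling of variables: at a maximum of \<open>h y + S z - \<eta> |z - z0|\<^sup>2 - K |y - f z|\<^sup>2\<close> the pair
  \<open>(y, z)\<close> is moved along \<open>(df w, w)\<close>. Since \<open>f\<close> is conformal, \<open>y + df w\<close> parametrizes
  a conformal plane, and since \<open>f\<close> is harmonic, the penalty contributes nothing to the trace.\<close>

lemma no_local_max_viscosity_compose:
  fixes f :: "complex \<Rightarrow> 'a::euclidean_space"
  assumes G: "open G" "continuous_on G h" "\<And>y. y \<in> G \<Longrightarrow> viscosity_MPSH_at h y"
    and D: "open D" "conformal_map_on f D" "harmonic_map_on f D" "f ` D \<subseteq> G"
    and S: "continuous_on D S" "\<kappa> > 0"
      "\<And>z. z \<in> D \<Longrightarrow> \<exists>l1 l2 a b c. a + c \<ge> \<kappa> \<and> upper_o2 (\<lambda>w. S z + quad l1 l2 a b c w - S (z + w))"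
    and z0: "z0 \<in> D"
  shows "\<exists>z\<in>D. h (f z) + S z > h (f z0) + S z0"
proof (rule ccontr)
  assume "\<not> ?thesis"
  then have max0: "\<And>z. z \<in> D \<Longrightarrow> h (f z) + S z \<le> h (f z0) + S z0" by force
  define M0 where "M0 = h (f z0) + S z0"
  have C1: "C1_map_on f D" using D(2) by (simp add: conformal_map_on_def)
  then have contf: "continuous_on D f" by (rule C1_map_on_continuous_on)
  obtain R where R: "R > 0" "cball (f z0) R \<subseteq> G"
    using G(1) D(4) z0 open_contains_cball by (metis image_subset_iff)
  have "open (D \<inter> f -` ball (f z0) (R/2))"
    by (rule continuous_open_preimage[OF contf D(1)]) simp
  moreover have "z0 \<in> D \<inter> f -` ball (f z0) (R/2)" using z0 R(1) by simp
  ultimately obtain \<rho> where \<rho>: "\<rho> > 0" "cball z0 \<rho> \<subseteq> D \<inter> f -` ball (f z0) (R/2)"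
    using open_contains_cball by blast
  define K1 where "K1 = cball (f z0) R"
  define K2 where "K2 = cball z0 \<rho>"
  have K2D: "K2 \<subseteq> D" using \<rho>(2) by (auto simp: K2_def)
  have fK2: "dist (f z0) (f z) < R / 2" if "z \<in> K2" for z using \<rho>(2) that by (auto simp: K2_def)
  have cpt: "compact (K1 \<times> K2)" by (simp add: K1_def K2_def compact_Times)
  have base: "(f z0, z0) \<in> K1 \<times> K2" using R(1) \<rho>(1) by (simp add: K1_def K2_def)
  \<comment> \<open>The localizing term makes \<open>z0\<close> a strict maximum and uses
    \<open>2 * \<eta>\<close> of the trace, half of the available \<open>\<kappa>\<close>.\<close>
  define \<eta> where "\<eta> = \<kappa> / 4"
  have \<eta>: "\<eta> > 0" using S(2) by (simp add: \<eta>_def)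
  define T where "T = (\<lambda>z. S z - \<eta> * (norm (z - z0))\<^sup>2)"
  have contT: "continuous_on K2 T" unfolding T_def
    by (intro continuous_intros continuous_on_subset[OF S(1) K2D])
  have conth: "continuous_on K1 h" using G(2) R(2) by (auto simp: K1_def intro: continuous_on_subset)
  have contfK: "continuous_on K2 f" using contf K2D by (rule continuous_on_subset)
  have conthT: "continuous_on (K1 \<times> K2) (\<lambda>p. h (fst p) + T (snd p))"
    by (intro continuous_intros continuous_on_compose2[OF conth] continuous_on_compose2[OF contT]) auto
  obtain Mb where Mb: "\<And>y z. y \<in> K1 \<Longrightarrow> z \<in> K2 \<Longrightarrow> h y + T z \<le> Mb"
    using continuous_attains_sup[OF cpt _ conthT] base by fastforce
  have "Mb \<ge> M0" using Mb[of "f z0" z0] base by (simp add: T_def M0_def)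
  have "uniformly_continuous_on K1 h"
    using conth by (rule compact_uniformly_continuous) (simp add: K1_def)
  moreover have "\<eta> * \<rho>\<^sup>2 / 2 > 0" using \<eta> \<rho>(1) by simp
  ultimately obtain \<tau>0 where \<tau>0: "\<tau>0 > 0"
    "\<And>y y'. y \<in> K1 \<Longrightarrow> y' \<in> K1 \<Longrightarrow> dist y' y < \<tau>0 \<Longrightarrow> dist (h y') (h y) < \<eta> * \<rho>\<^sup>2 / 2"
    unfolding uniformly_continuous_on_def by metis
  define \<tau> where "\<tau> = min \<tau>0 (R / 2)"
  have \<tau>: "\<tau> > 0" using \<tau>0 R(1) by (simp add: \<tau>_def)
  \<comment> \<open>With this weight, a pair for which \<open>y\<close> and \<open>f z\<close> are
    at least \<open>\<tau>\<close> apart scores at most \<open>M0 - 1\<close>, less than the pair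
    \<open>(f z0, z0)\<close>.\<close>
  define K where "K = (Mb - M0 + 1) / \<tau>\<^sup>2"
  have K: "K > 0" "K * \<tau>\<^sup>2 = Mb - M0 + 1" using \<tau> \<open>Mb \<ge> M0\<close> by (auto simp: K_def)
  define g where "g = (\<lambda>p. h (fst p) + T (snd p) - K * (norm (fst p - f (snd p)))\<^sup>2)"
  have "continuous_on (K1 \<times> K2) g" unfolding g_def
    by (intro continuous_intros conthT continuous_on_compose2[OF contfK]) auto
  then obtain p1 where p1: "p1 \<in> K1 \<times> K2" "\<And>p. p \<in> K1 \<times> K2 \<Longrightarrow> g p \<le> g p1"
    using continuous_attains_sup[OF cpt] base by blast
  obtain y z where yz: "p1 = (y, z)" by force
  have y: "y \<in> K1" and z: "z \<in> K2" using p1 yz by auto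
  have gM: "g (y, z) \<ge> M0" using p1(2)[OF base] by (simp add: yz g_def T_def M0_def)
  have close: "dist y (f z) < \<tau>"
  proof (rule ccontr)
    assume "\<not> dist y (f z) < \<tau>"
    then have "\<tau>\<^sup>2 \<le> (norm (y - f z))\<^sup>2" using \<tau> by (intro power_mono) (auto simp: dist_norm)
    then have "K * \<tau>\<^sup>2 \<le> K * (norm (y - f z))\<^sup>2" using K(1) by simp
    then show False using gM Mb[OF y z] K(2) by (simp add: g_def)
  qed
  have y_int: "y \<in> ball (f z0) R"
    using close fK2[OF z] dist_triangle[of "f z0" y "f z"] by (simp add: \<tau>_def dist_commute)
  \<comment> \<open>Replacing \<open>y\<close> by \<open>f z\<close> costs less than half of what
    the localizing term subtracts on the rim of \<open>K2\<close>, so the maximum is not attained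
    with \<open>z\<close> on the rim. Being interior, the maximum point can be displaced in every
    direction.\<close>
  have "f z \<in> K1" using fK2[OF z] R(1) by (simp add: K1_def)
  then have "dist (h y) (h (f z)) < \<eta> * \<rho>\<^sup>2 / 2" using \<tau>0(2) y close by (simp add: \<tau>_def)
  moreover have "M0 \<le> h y + T z" using gM K(1) by (simp add: g_def) (smt (verit) zero_le_power2 mult_nonneg_nonneg)
  ultimately have "M0 < h (f z) + S z + \<eta> * \<rho>\<^sup>2 / 2 - \<eta> * (norm (z - z0))\<^sup>2"
    unfolding T_def dist_real_def by linarith
  also have "h (f z) + S z \<le> M0" using max0 z K2D by (auto simp: M0_def)
  finally have "\<eta> * (norm (z - z0))\<^sup>2 < \<eta> * (\<rho>\<^sup>2 / 2)" by simp
  then have "(norm (z - z0))\<^sup>2 < \<rho>\<^sup>2" using \<eta> by (simp) (smt (verit) zero_le_power2)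
  then have z_int: "z \<in> ball z0 \<rho>"
    using \<rho>(1) by (simp add: dist_norm norm_minus_commute power2_less_imp_less)
  have zD: "z \<in> D" using z K2D by auto

  let ?fx = "partial_x f z" and ?fy = "partial_y f z"
  let ?fxx = "partial_x (partial_x f) z" and ?fyy = "partial_y (partial_y f) z"
  obtain b where jet: "upper_o2 (\<lambda>w. norm (f (z + w) - f z
      - quad ?fx ?fy ((1/2) *\<^sub>R ?fxx) b ((1/2) *\<^sub>R ?fyy) w))"
    using C2_taylor[OF D(1) zD] D(3) by (auto simp: harmonic_map_on_def)
  obtain l1 l2 a' b' c' where SJ: "a' + c' \<ge> \<kappa>" "upper_o2 (\<lambda>w. S z + quad l1 l2 a' b' c' w - S (z + w))"
    using S(3)[OF zD] by blast
  have conf: "norm ?fx = norm ?fy" "?fx \<bullet> ?fy = 0" using D(2) zD by (auto simp: conformal_map_on_def)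
  have harm: "?fxx + ?fyy = 0" using D(3) zD by (auto simp: harmonic_map_on_def)
  define c where "c = y - f z"
  define q2 where "q2 = quad 0 0 ((1/2) *\<^sub>R ?fxx) b ((1/2) *\<^sub>R ?fyy)"
  \<comment> \<open>The displacement turns the gap \<open>c\<close> into \<open>c - E w\<close>.
    Thus the penalty changes only by second-order terms, with quadratic part
    \<open>- 2 * K * (c \<bullet> q2 w)\<close> in the subtracted square.\<close>
  define E where "E = (\<lambda>w. f (z + w) - f z - Re w *\<^sub>R ?fx - Im w *\<^sub>R ?fy)"
  have Eq: "upper_o2 (\<lambda>w. norm (E w - q2 w))"
    using jet by (simp add: E_def q2_def quad_def algebra_simps)
  have E2: "upper_o2 (\<lambda>w. (norm (E w))\<^sup>2)"
  proof (rule upper_o2_cube)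
    define Q where "Q = norm ((1/2) *\<^sub>R ?fxx) + norm b + norm ((1/2) *\<^sub>R ?fyy) + 1"
    have "Q \<ge> 0" by (simp add: Q_def add_nonneg_nonneg)
    have "\<forall>\<^sub>F w in nhds 0. norm (E w - q2 w) \<le> 1 * (norm w)\<^sup>2"
      using Eq unfolding upper_o2_def by (meson zero_less_one)
    with eventually_norm_less[OF zero_less_one]
    show "\<forall>\<^sub>F w in nhds 0. (norm (E w))\<^sup>2 \<le> Q\<^sup>2 * norm w ^ 3"
    proof eventually_elim
      case (elim w)
      have "norm (E w) \<le> norm (q2 w) + norm (E w - q2 w)" by (rule norm_triangle_sub)
      also have "\<dots> \<le> Q * (norm w)\<^sup>2"
        using elim(2) quad_bound[of "(1/2) *\<^sub>R ?fxx" b "(1/2) *\<^sub>R ?fyy" w]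
        unfolding Q_def q2_def distrib_right by linarith
      finally have "(norm (E w))\<^sup>2 \<le> (Q * (norm w)\<^sup>2)\<^sup>2" by (intro power_mono) auto
      also have "\<dots> = Q\<^sup>2 * norm w ^ 3 * norm w" by (simp add: power_mult_distrib eval_nat_numeral)
      also have "\<dots> \<le> Q\<^sup>2 * norm w ^ 3 * 1" using elim(1) by (intro mult_left_mono) auto
      finally show ?case by simp
    qed
  qed
  define d where "d = z - z0"
  have up: "upper_o2 (\<lambda>w. (S z + quad l1 l2 a' b' c' w - S (z + w))
     + (K * (2 * norm c) * norm (E w - q2 w) + K * (norm (E w))\<^sup>2))"
    using K(1) by (intro upper_o2_add SJ(2) upper_o2_cmult Eq E2) auto
  define A1 where "A1 = - a' + \<eta> - K * (c \<bullet> ?fxx)"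
  define C1 where "C1 = - c' + \<eta> - K * (c \<bullet> ?fyy)"
  have "upper_o2 (\<lambda>w. h (y + Re w *\<^sub>R ?fx + Im w *\<^sub>R ?fy) - h y
     - quad (2 * \<eta> * Re d - l1) (2 * \<eta> * Im d - l2) A1 (- b' - 2 * K * (c \<bullet> b)) C1 w)"
  proof (rule upper_o2_mono[OF up])
    have "\<forall>\<^sub>F x in nhds y. x \<in> K1"
      using eventually_nhds_in_open[OF open_ball y_int] by eventually_elim (auto simp: K1_def)
    from eventually_plane[OF this]
    have e1: "\<forall>\<^sub>F w in nhds 0. y + Re w *\<^sub>R ?fx + Im w *\<^sub>R ?fy \<in> K1" .
    have "\<forall>\<^sub>F x in nhds z. x \<in> K2"
      using eventually_nhds_in_open[OF open_ball z_int] by eventually_elim (auto simp: K2_def)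
    from eventually_plane[OF this, of 1 \<i>]
    have e2: "\<forall>\<^sub>F w in nhds 0. z + w \<in> K2"
      by (rule eventually_mono) (simp add: complex_eq[symmetric] add.assoc scaleR_conv_of_real mult.commute)
    from e1 e2
    show "\<forall>\<^sub>F w in nhds 0. h (y + Re w *\<^sub>R ?fx + Im w *\<^sub>R ?fy) - h y
       - quad (2 * \<eta> * Re d - l1) (2 * \<eta> * Im d - l2) A1 (- b' - 2 * K * (c \<bullet> b)) C1 w
       \<le> (S z + quad l1 l2 a' b' c' w - S (z + w))
         + (K * (2 * norm c) * norm (E w - q2 w) + K * (norm (E w))\<^sup>2)"
    proof eventually_elim
      case (elim w)
      let ?y = "y + Re w *\<^sub>R ?fx + Im w *\<^sub>R ?fy"
      have "g (?y, z + w) \<le> g (y, z)" using p1(2)[of "(?y, z + w)"] elim by (simp add: yz)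
      moreover have "?y - f (z + w) = c - E w" by (simp add: c_def E_def algebra_simps)
      then have "g (?y, z + w) = h ?y + T (z + w) - K * (norm (c - E w))\<^sup>2"
        by (simp only: g_def fst_conv snd_conv)
      moreover have "g (y, z) = h y + T z - K * (norm c)\<^sup>2" by (simp add: g_def c_def)
      ultimately have "h ?y - h y \<le> T z - T (z + w) + K * ((norm (c - E w))\<^sup>2 - (norm c)\<^sup>2)"
        by (simp add: right_diff_distrib)
      also have "(norm (c - E w))\<^sup>2 - (norm c)\<^sup>2 = - 2 * (c \<bullet> q2 w) - 2 * (c \<bullet> (E w - q2 w)) + (norm (E w))\<^sup>2"
        by (simp add: power2_norm_eq_inner algebra_simps inner_commute)
      also have "\<dots> \<le> - 2 * (c \<bullet> q2 w) + 2 * (norm c * norm (E w - q2 w)) + (norm (E w))\<^sup>2"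
        using Cauchy_Schwarz_ineq2[of c "E w - q2 w"] by (simp add: abs_le_iff)
      finally have "h ?y - h y \<le> T z - T (z + w)
          + K * (- 2 * (c \<bullet> q2 w) + 2 * (norm c * norm (E w - q2 w)) + (norm (E w))\<^sup>2)"
        using K(1) by (smt (verit) mult_left_mono)
      moreover have "T z - T (z + w)
        = S z - S (z + w) + \<eta> * (2 * Re d * Re w + 2 * Im d * Im w + (Re w)\<^sup>2 + (Im w)\<^sup>2)"
        unfolding T_def d_def cmod_power2 by (simp add: algebra_simps power2_eq_square)
      moreover have "c \<bullet> q2 w = quad 0 0 (c \<bullet> ?fxx / 2) (c \<bullet> b) (c \<bullet> ?fyy / 2) w"
        by (simp add: q2_def inner_quad)
      ultimately show ?case
        by (simp add: quad_def A1_def C1_def algebra_simps)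
    qed
  qed
  then have "A1 + C1 \<ge> 0"
    using G(3)[of y] y R(2) conf unfolding viscosity_MPSH_at_def K1_def by blast
  moreover have "A1 + C1 = - (a' + c') + 2 * \<eta> - K * (c \<bullet> (?fxx + ?fyy))"
    by (simp add: A1_def C1_def algebra_simps inner_add_right)
  ultimately show False using SJ(1) S(2) harm by (simp add: \<eta>_def)
qed

section \<open>Radial functions and a cut off logarithm\<close>

lemma quad_add:
  "quad l1 l2 a b c w + quad l1' l2' a' b' c' w = quad (l1+l1') (l2+l2') (a+a') (b+b') (c+c') w"
  by (simp add: quad_def algebra_simps)

lemma quad_cmult:
  fixes k :: real
  shows "k * quad l1 l2 a b c w = quad (k*l1) (k*l2) (k*a) (k*b) (k*c) w"
  by (simp add: quad_def algebra_simps)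

text \<open>Conformality makes the increment of the squared distance exactly a linear part plus a
  multiple of \<open>(norm w)\<^sup>2\<close>. The factor of \<open>p2\<close> measures how much of
  \<open>y - q\<close> lies in the plane.\<close>

lemma radial_jet:
  fixes y q e1 e2 :: "'a::real_inner" and \<Phi> :: "real \<Rightarrow> real"
  assumes e: "norm e1 = norm e2" "e1 \<bullet> e2 = 0"
    and \<Phi>: "upper_o2 (\<lambda>h. \<bar>\<Phi> (k * (norm (y - q))\<^sup>2 + h) - \<Phi> (k * (norm (y - q))\<^sup>2) - p1 * h - p2 / 2 * h\<^sup>2\<bar>)"
  shows "\<exists>l1 l2 a b c. a + c = 2 * k * p1 * (norm e1)\<^sup>2 + 2 * k\<^sup>2 * p2 * (((y - q) \<bullet> e1)\<^sup>2 + ((y - q) \<bullet> e2)\<^sup>2)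
    \<and> upper_o2 (\<lambda>w. \<bar>\<Phi> (k * (norm (y + Re w *\<^sub>R e1 + Im w *\<^sub>R e2 - q))\<^sup>2)
        - \<Phi> (k * (norm (y - q))\<^sup>2) - quad l1 l2 a b c w\<bar>)"
proof -
  define \<alpha> \<beta> \<mu> where "\<alpha> = 2 * k * ((y - q) \<bullet> e1)" "\<beta> = 2 * k * ((y - q) \<bullet> e2)" "\<mu> = k * (norm e1)\<^sup>2"
  have sq: "k * (norm (y + Re w *\<^sub>R e1 + Im w *\<^sub>R e2 - q))\<^sup>2
    = k * (norm (y - q))\<^sup>2 + (Re w * \<alpha> + Im w * \<beta> + \<mu> * (norm w)\<^sup>2)" for w
  proof -
    have "e2 \<bullet> e2 = e1 \<bullet> e1" "e2 \<bullet> e1 = 0" using e by (simp_all add: norm_eq_sqrt_inner inner_commute)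
    moreover have "y + Re w *\<^sub>R e1 + Im w *\<^sub>R e2 - q = (y - q) + Re w *\<^sub>R e1 + Im w *\<^sub>R e2" by simp
    ultimately show ?thesis
      using e(2) unfolding cmod_power2 \<alpha>_\<beta>_\<mu>_def
      by (simp only: power2_norm_eq_inner inner_add_left inner_add_right inner_scaleR_left inner_scaleR_right
          inner_commute[of e1 "y - q"] inner_commute[of e2 "y - q"])
        (simp add: algebra_simps power2_eq_square)
  qed
  have "(p1 * \<mu> + p2 / 2 * \<alpha>\<^sup>2) + (p1 * \<mu> + p2 / 2 * \<beta>\<^sup>2)
    = 2 * k * p1 * (norm e1)\<^sup>2 + 2 * k\<^sup>2 * p2 * (((y - q) \<bullet> e1)\<^sup>2 + ((y - q) \<bullet> e2)\<^sup>2)"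
    by (simp add: \<alpha>_\<beta>_\<mu>_def algebra_simps power2_eq_square)
  moreover have "upper_o2 (\<lambda>w. \<bar>\<Phi> (k * (norm (y + Re w *\<^sub>R e1 + Im w *\<^sub>R e2 - q))\<^sup>2)
        - \<Phi> (k * (norm (y - q))\<^sup>2)
        - quad (p1 * \<alpha>) (p1 * \<beta>) (p1 * \<mu> + p2 / 2 * \<alpha>\<^sup>2) (p2 * \<alpha> * \<beta>) (p1 * \<mu> + p2 / 2 * \<beta>\<^sup>2) w\<bar>)"
    unfolding sq by (rule upper_o2_compose_quadratic[OF \<Phi>])
  ultimately show ?thesis by blast
qed

text \<open>Cauchy-Schwarz against \<open>v\<close>, which is \<open>e1 \<bullet> e1\<close> times
  the orthogonal projection of \<open>x\<close> to the plane. For a concave radial profile this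
  controls the term with the unfavourable sign.\<close>

lemma conformal_bessel:
  fixes x e1 e2 :: "'a::real_inner"
  assumes "norm e1 = norm e2" "e1 \<bullet> e2 = 0"
  shows "(x \<bullet> e1)\<^sup>2 + (x \<bullet> e2)\<^sup>2 \<le> (norm x)\<^sup>2 * (norm e1)\<^sup>2"
proof -
  define s where "s = (x \<bullet> e1)\<^sup>2 + (x \<bullet> e2)\<^sup>2"
  define v where "v = (x \<bullet> e1) *\<^sub>R e1 + (x \<bullet> e2) *\<^sub>R e2"
  have "e2 \<bullet> e2 = e1 \<bullet> e1" "e2 \<bullet> e1 = 0" using assms by (simp_all add: norm_eq_sqrt_inner inner_commute)
  then have v: "v \<bullet> v = s * (e1 \<bullet> e1)" and xv: "x \<bullet> v = s"
    using assms(2) by (simp_all add: v_def s_def algebra_simps power2_eq_square)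
  have "s \<ge> 0" by (simp add: s_def)
  have "s * s \<le> (x \<bullet> x) * (s * (e1 \<bullet> e1))"
    using Cauchy_Schwarz_ineq[of x v] by (simp add: v xv power2_eq_square)
  then have "s * s \<le> s * ((x \<bullet> x) * (e1 \<bullet> e1))" by (simp add: mult_ac)
  then have "s \<le> (x \<bullet> x) * (e1 \<bullet> e1)"
    using \<open>s \<ge> 0\<close> by (cases "s = 0") (auto simp: mult_le_cancel_left)
  then show ?thesis by (simp add: s_def power2_norm_eq_inner)
qed

text \<open>The Taylor terms make the function of class \<open>C\<^sup>2\<close> at \<open>v = 1\<close>.\<close>

definition log_cutoff :: "real \<Rightarrow> real" where
  "log_cutoff v = (if v < 1 then ln v + (1 - v) + (1 - v)\<^sup>2 / 2 else 0)"

lemma DERIV_log_cutoff_branch: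
  "v > 0 \<Longrightarrow> ((\<lambda>v. ln v + (1 - v) + (1 - v)\<^sup>2 / 2) has_real_derivative (1/v - 2 + v)) (at v)"
  by (auto intro!: derivative_eq_intros simp: field_simps)

text \<open>The derivative is a square divided by a positive number. This one formula yields both
  the sign and the cubic vanishing at \<open>1\<close>.\<close>

lemma log_cutoff_mean_value:
  assumes "0 < v" "v < 1"
  shows "\<exists>\<xi>>v. \<xi> < 1 \<and> log_cutoff v = - ((1 - v) * ((1 - \<xi>)\<^sup>2 / \<xi>))"
proof -
  let ?\<psi> = "\<lambda>v::real. ln v + (1 - v) + (1 - v)\<^sup>2 / 2"
  have "\<exists>\<xi>>v. \<xi> < 1 \<and> ?\<psi> 1 - ?\<psi> v = (1 - v) * (1/\<xi> - 2 + \<xi>)"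
    by (rule MVT2[OF assms(2)]) (use assms DERIV_log_cutoff_branch in auto)
  then obtain \<xi> where \<xi>: "v < \<xi>" "\<xi> < 1" "- ?\<psi> v = (1 - v) * (1/\<xi> - 2 + \<xi>)" by auto
  moreover have "1/\<xi> - 2 + \<xi> = (1 - \<xi>)\<^sup>2 / \<xi>"
    using \<xi> assms by (simp add: field_simps power2_eq_square)
  ultimately have "log_cutoff v = - ((1 - v) * ((1 - \<xi>)\<^sup>2 / \<xi>))"
    using assms(2) by (simp add: log_cutoff_def)
  then show ?thesis using \<xi>(1,2) by blast
qed

lemma log_cutoff_nonpos:
  assumes "v > 0" shows "log_cutoff v \<le> 0"
proof (cases "v < 1")
  case True
  then obtain \<xi> where "v < \<xi>" "\<xi> < 1" "log_cutoff v = - ((1 - v) * ((1 - \<xi>)\<^sup>2 / \<xi>))"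
    using log_cutoff_mean_value[OF assms] by blast
  then show ?thesis using assms True by simp
qed (simp add: log_cutoff_def)

lemma log_cutoff_ge_cubic:
  assumes "1/2 \<le> v" "v < 1"
  shows "- 2 * (1 - v) ^ 3 \<le> log_cutoff v"
proof -
  obtain \<xi> where \<xi>: "v < \<xi>" "\<xi> < 1" "log_cutoff v = - ((1 - v) * ((1 - \<xi>)\<^sup>2 / \<xi>))"
    using log_cutoff_mean_value[of v] assms by auto
  have "(1 - \<xi>)\<^sup>2 / \<xi> \<le> (1 - v)\<^sup>2 / (1/2)"
    using \<xi> assms by (intro frac_le power_mono) auto
  then have "(1 - v) * ((1 - \<xi>)\<^sup>2 / \<xi>) \<le> (1 - v) * (2 * (1 - v)\<^sup>2)"
    using assms by (intro mult_left_mono) auto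
  also have "\<dots> = 2 * (1 - v) ^ 3" by (simp add: power3_eq_cube power2_eq_square)
  finally show ?thesis using \<xi>(3) by linarith
qed

lemma log_cutoff_le_ln:
  assumes "v > 0" shows "log_cutoff v \<le> ln v + 3/2"
proof (cases "v < 1")
  case True
  then have "(1 - v)\<^sup>2 \<le> 1" using assms by (simp add: power_le_one)
  then show ?thesis using True assms by (simp add: log_cutoff_def)
qed (simp add: log_cutoff_def)

lemma continuous_on_log_cutoff: "continuous_on {0<..} log_cutoff"
proof -
  have "log_cutoff v = ln (min v 1) + (1 - min v 1) + (1 - min v 1)\<^sup>2 / 2" for v
    by (auto simp: log_cutoff_def min_def)
  then have eq: "log_cutoff = (\<lambda>v. ln (min v 1) + (1 - min v 1) + (1 - min v 1)\<^sup>2 / 2)" by (rule ext)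
  show ?thesis unfolding eq by (intro continuous_intros) auto
qed

text \<open>\<open>p1 + v * p2\<close> is a quarter of the Laplacian on a plane through the pole,
  the worst planes because \<open>p2 \<le> 0\<close>. For \<open>v < 1\<close> the logarithm
  contributes nothing and the Taylor terms contribute \<open>2 * v - 2\<close>, whence the bound
  \<open>-2\<close>.\<close>

lemma log_cutoff_jet:
  assumes v: "v > 0"
  shows "\<exists>p1 p2. p2 \<le> 0 \<and> p1 + v * p2 \<ge> -2 \<and> (v \<ge> 1 \<longrightarrow> p1 = 0 \<and> p2 = 0) \<and>
    upper_o2 (\<lambda>h. \<bar>log_cutoff (v + h) - log_cutoff v - p1 * h - p2 / 2 * h\<^sup>2\<bar>)"
proof (cases v "1::real" rule: linorder_cases)
  case less
  have near: "\<forall>\<^sub>F x in nhds v. x \<in> {0<..<1}"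
    by (rule eventually_nhds_in_open) (use v less in auto)
  have der: "\<forall>\<^sub>F x in nhds v. (log_cutoff has_real_derivative (1/x - 2 + x)) (at x)"
    using near
  proof eventually_elim
    case (elim x)
    show ?case
      by (rule DERIV_cong_ev[THEN iffD1, OF refl _ refl DERIV_log_cutoff_branch])
        (use elim eventually_nhds_in_open[of "{..<1::real}" x] in \<open>auto simp: log_cutoff_def elim!: eventually_mono\<close>)
  qed
  have der2: "((\<lambda>x. 1/x - 2 + x) has_real_derivative (1 - 1/v\<^sup>2)) (at v)"
    using v by (auto intro!: derivative_eq_intros simp: power2_eq_square)
  have "v\<^sup>2 \<le> 1" using v less by (simp add: power_le_one)
  then have "1 - 1/v\<^sup>2 \<le> 0" using v by (simp add: field_simps)
  moreover have "(1/v - 2 + v) + v * (1 - 1/v\<^sup>2) \<ge> -2" using v by (simp add: field_simps power2_eq_square)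
  ultimately show ?thesis using real_taylor2[OF der der2] less by (intro exI conjI) auto
next
  case equal
  \<comment> \<open>At the seam both branches agree with \<open>0\<close> up to third order, so the
    zero jet is valid.\<close>
  have "upper_o2 (\<lambda>h. \<bar>log_cutoff (1 + h) - log_cutoff 1 - 0 * h - 0 / 2 * h\<^sup>2\<bar>)"
  proof (rule upper_o2_cube)
    have "(0::real) < 1/2" by simp
    from eventually_norm_less[OF this]
    show "\<forall>\<^sub>F h in nhds (0::real). \<bar>log_cutoff (1 + h) - log_cutoff 1 - 0 * h - 0 / 2 * h\<^sup>2\<bar> \<le> 2 * norm h ^ 3"
    proof eventually_elim
      case (elim h)
      show ?case
      proof (cases "h < 0")
        case True
        then have "- 2 * (- h) ^ 3 \<le> log_cutoff (1 + h) \<and> log_cutoff (1 + h) \<le> 0"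
          using log_cutoff_ge_cubic[of "1 + h"] log_cutoff_nonpos[of "1 + h"] elim by simp
        then show ?thesis using True by (auto simp: log_cutoff_def)
      qed (simp add: log_cutoff_def)
    qed
  qed
  then show ?thesis using equal by (intro exI[of _ 0]) simp
next
  case greater
  have "upper_o2 (\<lambda>h. \<bar>log_cutoff (v + h) - log_cutoff v - 0 * h - 0 / 2 * h\<^sup>2\<bar>)"
  proof (rule upper_o2_mono[OF upper_o2_0])
    have "v - 1 > 0" using greater by simp
    from eventually_norm_less[OF this]
    show "\<forall>\<^sub>F h in nhds 0. \<bar>log_cutoff (v + h) - log_cutoff v - 0 * h - 0 / 2 * h\<^sup>2\<bar> \<le> 0"
      by eventually_elim (auto simp: log_cutoff_def)
  qed
  then show ?thesis by (intro exI[of _ 0]) simp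
qed

text \<open>The radial computation with \<open>e1 = 1\<close> and \<open>e2 = \<i>\<close>. The
  plane is everything, so the Bessel inequality becomes an equality and the two contributions to the
  trace cancel.\<close>

lemma log_jet:
  fixes z b :: complex
  assumes "z \<noteq> b"
  shows "\<exists>l1 l2 a m c. a + c = 0 \<and>
    upper_o2 (\<lambda>w. \<bar>ln ((norm (z + w - b))\<^sup>2) - ln ((norm (z - b))\<^sup>2) - quad l1 l2 a m c w\<bar>)"
proof -
  define N where "N = (norm (z - b))\<^sup>2"
  have N: "N > 0" using assms by (simp add: N_def)
  have "\<forall>\<^sub>F v in nhds N. v \<in> {0<..}" by (rule eventually_nhds_in_open) (use N in auto)
  then have der: "\<forall>\<^sub>F v in nhds N. (ln has_real_derivative (1/v)) (at v)"
    by eventually_elim (auto intro!: derivative_eq_intros)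
  have der2: "((\<lambda>v. 1/v) has_real_derivative (- 1/N\<^sup>2)) (at N)"
    using N by (auto intro!: derivative_eq_intros simp: power2_eq_square)
  note T = real_taylor2[OF der der2]
  have "\<exists>l1 l2 a m c. a + c = 2 * 1 * (1/N) * (norm (1::complex))\<^sup>2
        + 2 * 1\<^sup>2 * (- 1/N\<^sup>2) * (((z - b) \<bullet> 1)\<^sup>2 + ((z - b) \<bullet> \<i>)\<^sup>2)
    \<and> upper_o2 (\<lambda>w. \<bar>ln (1 * (norm (z + Re w *\<^sub>R 1 + Im w *\<^sub>R \<i> - b))\<^sup>2)
        - ln (1 * (norm (z - b))\<^sup>2) - quad l1 l2 a m c w\<bar>)"
    by (rule radial_jet) (use T in \<open>simp_all add: N_def inner_complex_def\<close>)
  moreover have "z + Re w *\<^sub>R 1 + Im w *\<^sub>R \<i> = z + w" for w by (simp add: complex_eq_iff)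
  moreover have "2 * 1 * (1/N) * (norm (1::complex))\<^sup>2
        + 2 * 1\<^sup>2 * (- 1/N\<^sup>2) * (((z - b) \<bullet> 1)\<^sup>2 + ((z - b) \<bullet> \<i>)\<^sup>2) = 0"
  proof -
    have "((z - b) \<bullet> 1)\<^sup>2 + ((z - b) \<bullet> \<i>)\<^sup>2 = N" by (simp add: inner_complex_def N_def cmod_power2)
    then show ?thesis using N by (simp add: power2_eq_square)
  qed
  ultimately show ?thesis by simp
qed

section \<open>The barrier\<close>

text \<open>\<open>u_shell\<close> keeps the modified function nonpositive, \<open>u_sphere\<close>
  lets the constant \<open>- 2 * m\<close> win near radius \<open>r\<close>, and
  \<open>u_near\<close> keeps that constant out of the ball of radius \<open>8 * s\<close> in which
  the pole is placed.\<close>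

locale peak_barrier =
  fixes \<Omega> U :: "'a::euclidean_space set" and u :: "'a \<Rightarrow> real" and p :: 'a and a s r m :: real
  assumes openG: "open \<Omega>" "open U" and cont_u: "continuous_on (\<Omega> \<inter> U) u"
    and visc_u: "\<And>y. y \<in> \<Omega> \<inter> U \<Longrightarrow> viscosity_MPSH_at u y"
    and u_nonpos: "\<And>y. y \<in> \<Omega> \<inter> U \<Longrightarrow> u y \<le> 0"
    and ballU: "cball p r \<subseteq> U"
    and pos: "s > 0" "8 * s < r" "a > 0" "m > 0"
    and u_shell: "\<And>y. y \<in> \<Omega> \<Longrightarrow> s \<le> norm (y - p) \<Longrightarrow> norm (y - p) \<le> r
      \<Longrightarrow> u y + a * ((norm (y - p))\<^sup>2 - s\<^sup>2) \<le> 0"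
    and u_sphere: "\<And>y. y \<in> \<Omega> \<Longrightarrow> norm (y - p) = r \<Longrightarrow> u y + a * ((norm (y - p))\<^sup>2 - s\<^sup>2) < - 2 * m"
    and u_near: "\<And>y. y \<in> \<Omega> \<Longrightarrow> norm (y - p) < 8 * s \<Longrightarrow> u y > - m"
begin

definition bump :: "'a \<Rightarrow> real" where
  "bump x = a * max 0 ((norm (x - p))\<^sup>2 - s\<^sup>2)"

definition base :: "'a \<Rightarrow> real" where
  "base x = (if norm (x - p) < r then max (u x + bump x) (- 2 * m) else - 2 * m)"

text \<open>With coefficient \<open>A\<close> in front, the trace of the cut off logarithm is at
  least \<open>- (A / s\<^sup>2) * (norm e1)\<^sup>2\<close>. The value
  \<open>A = 2 * a * s\<^sup>2\<close> makes this exactly what the trace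
  \<open>2 * a * (norm e1)\<^sup>2\<close> of \<open>bump\<close> outside radius \<open>s\<close>
  can absorb.\<close>

definition cutoff :: "'a \<Rightarrow> 'a \<Rightarrow> real" where
  "cutoff q x = (2 * a * s\<^sup>2) * log_cutoff ((norm (x - q))\<^sup>2 / (2 * s)\<^sup>2)"

definition barrier :: "'a \<Rightarrow> 'a \<Rightarrow> real" where
  "barrier q x = base x + cutoff q x"

lemma bump_nonneg: "bump x \<ge> 0"
  using pos by (simp add: bump_def)

lemma cont_u_at:
  assumes "y \<in> \<Omega>" "norm (y - p) \<le> r" shows "isCont (\<lambda>x. u x + bump x) y"
proof -
  have "y \<in> \<Omega> \<inter> U" using assms ballU by (auto simp: dist_norm norm_minus_commute)
  then have "isCont u y"
    using cont_u openG by (simp add: continuous_on_eq_continuous_at open_Int)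
  then show ?thesis unfolding bump_def by (intro continuous_intros)
qed

lemma tendsto_u_bump:
  assumes "y \<in> \<Omega>" "norm (y - p) \<le> r"
  shows "((\<lambda>x. u x + bump x) \<longlongrightarrow> u y + bump y) (nhds y)"
  using cont_u_at[OF assms] tendsto_at_iff_tendsto_nhds[of "\<lambda>x. u x + bump x" y]
  by (simp add: isCont_def)

text \<open>The delicate radius is \<open>r\<close>: by \<open>u_sphere\<close> the maximum already
  equals the constant in a neighbourhood, so the two branches of the definition agree there.\<close>

lemma isCont_base:
  assumes y: "y \<in> \<Omega>" shows "isCont base y"
proof (cases "norm (y - p)" r rule: linorder_cases)
  case less
  have "\<forall>\<^sub>F x in nhds y. x \<in> ball p r"
    by (rule eventually_nhds_in_open) (use less in \<open>auto simp: dist_norm norm_minus_commute\<close>)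
  then have "\<forall>\<^sub>F x in nhds y. base x = max (u x + bump x) (- 2 * m)"
    by eventually_elim (auto simp: base_def dist_norm norm_minus_commute)
  then show ?thesis
    using continuous_max[OF cont_u_at[OF y] continuous_const[of _ "- 2 * m"]] less
    by (simp add: isCont_cong)
next
  case equal
  have "\<forall>\<^sub>F x in nhds y. u x + bump x < - 2 * m"
  proof -
    have "u y + bump y < - 2 * m"
      using u_sphere[OF y equal] pos equal by (simp add: bump_def max_def power_mono)
    then show ?thesis
      using tendsto_u_bump[OF y] equal by (auto intro: order_tendstoD(2))
  qed
  then have "\<forall>\<^sub>F x in nhds y. base x = - 2 * m" by eventually_elim (auto simp: base_def)
  then show ?thesis by (simp add: isCont_cong)
next
  case greater
  have "open (- cball p r)" by auto
  then have "\<forall>\<^sub>F x in nhds y. x \<in> - cball p r"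
    by (rule eventually_nhds_in_open) (use greater in \<open>auto simp: dist_norm norm_minus_commute\<close>)
  then have "\<forall>\<^sub>F x in nhds y. base x = - 2 * m"
    by eventually_elim (auto simp: base_def dist_norm norm_minus_commute)
  then show ?thesis by (simp add: isCont_cong)
qed

lemma base_nonpos:
  assumes y: "y \<in> \<Omega>" shows "base y \<le> 0"
proof (cases "norm (y - p) < r")
  case True
  have "u y + bump y \<le> 0"
  proof (cases "s \<le> norm (y - p)")
    case True
    then show ?thesis using u_shell[OF y True] \<open>norm (y - p) < r\<close> pos
      by (simp add: bump_def max_def power_mono)
  next
    case False
    then have "(norm (y - p))\<^sup>2 \<le> s\<^sup>2" by (intro power_mono) auto
    moreover have "y \<in> \<Omega> \<inter> U" using y True ballU by (auto simp: dist_norm norm_minus_commute)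
    ultimately show ?thesis using u_nonpos by (simp add: bump_def)
  qed
  then show ?thesis using pos by (simp add: base_def)
qed (use pos in \<open>simp add: base_def\<close>)

lemma base_ge: "base y \<ge> - 2 * m"
  by (simp add: base_def)

section \<open>The barrier with a pole at distance \<open>4 * s\<close> from the peak point\<close>

context
  fixes q assumes q: "norm (q - p) = 4 * s"
begin

lemma cutoff_eq_0: "norm (x - q) \<ge> 2 * s \<Longrightarrow> cutoff q x = 0"
  using pos power_mono[of "2 * s" "norm (x - q)" 2]
  by (simp add: cutoff_def log_cutoff_def not_less)

lemma cutoff_nonpos: "x \<noteq> q \<Longrightarrow> cutoff q x \<le> 0"
  using pos unfolding cutoff_def by (intro mult_nonneg_nonpos log_cutoff_nonpos) auto

lemma barrier_nonpos: "x \<in> \<Omega> \<Longrightarrow> x \<noteq> q \<Longrightarrow> barrier q x \<le> 0"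
  unfolding barrier_def using base_nonpos cutoff_nonpos by (simp add: add_nonpos_nonpos)

lemma barrier_le_ln:
  "x \<in> \<Omega> \<Longrightarrow> x \<noteq> q \<Longrightarrow> barrier q x \<le> (2 * a * s\<^sup>2) * (ln ((norm (x - q))\<^sup>2 / (2 * s)\<^sup>2) + 3/2)"
proof -
  assume x: "x \<in> \<Omega>" "x \<noteq> q"
  then have "cutoff q x \<le> (2 * a * s\<^sup>2) * (ln ((norm (x - q))\<^sup>2 / (2 * s)\<^sup>2) + 3/2)"
    using pos unfolding cutoff_def by (intro mult_left_mono log_cutoff_le_ln) auto
  then show ?thesis using base_nonpos[OF x(1)] by (simp add: barrier_def)
qed

text \<open>Meant for the centre of the disc. A point within \<open>s\<close> of \<open>p\<close> is
  at least \<open>3 * s\<close> away from \<open>q\<close>, hence outside the cutoff.\<close>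

lemma barrier_ge_near:
  assumes "norm (x - p) \<le> s" shows "barrier q x \<ge> u x"
proof -
  have "norm (q - p) \<le> norm (x - q) + norm (x - p)"
    by (metis norm_minus_commute norm_triangle_sub add.commute diff_add_cancel norm_triangle_ineq4 diff_diff_eq2)
  then have "cutoff q x = 0" using assms q pos by (intro cutoff_eq_0) simp
  then show ?thesis using assms pos bump_nonneg[of x] by (simp add: barrier_def base_def)
qed

lemma continuous_on_barrier: "continuous_on (\<Omega> - {q}) (barrier q)"
proof -
  have "continuous_on (\<Omega> - {q}) base"
    by (intro continuous_at_imp_continuous_on ballI isCont_base) auto
  moreover have "continuous_on (\<Omega> - {q}) (\<lambda>x. log_cutoff ((norm (x - q))\<^sup>2 / (2 * s)\<^sup>2))"
    by (rule continuous_on_compose2[OF continuous_on_log_cutoff]) (use pos in \<open>auto intro!: continuous_intros divide_pos_pos\<close>)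
  ultimately show ?thesis unfolding barrier_def cutoff_def by (intro continuous_intros)
qed

text \<open>As \<open>p2 \<le> 0\<close>, the Bessel bound replaces the in-plane part of
  \<open>y - q\<close> by its largest possible value, which leaves \<open>p1 + v * p2\<close>;
  scaling by \<open>2 * k * A = a\<close> gives the constant.\<close>

lemma cutoff_jet:
  assumes "y \<noteq> q" and e: "norm e1 = norm e2" "e1 \<bullet> e2 = 0"
  shows "\<exists>l1 l2 a' b c. a' + c \<ge> - 2 * a * (norm e1)\<^sup>2 \<and> (norm (y - q) \<ge> 2 * s \<longrightarrow> a' + c \<ge> 0) \<and>
    upper_o2 (\<lambda>w. cutoff q y + quad l1 l2 a' b c w - cutoff q (y + Re w *\<^sub>R e1 + Im w *\<^sub>R e2))"
proof -
  define k where "k = 1 / (2 * s)\<^sup>2"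
  define A where "A = 2 * a * s\<^sup>2"
  have kA: "k > 0" "A > 0" "A * k = a / 2" using pos by (simp_all add: k_def A_def power2_eq_square)
  define v where "v = k * (norm (y - q))\<^sup>2"
  have v: "v > 0" using assms(1) kA by (simp add: v_def)
  obtain p1 p2 where p12: "p2 \<le> 0" "p1 + v * p2 \<ge> -2" "v \<ge> 1 \<longrightarrow> p1 = 0 \<and> p2 = 0"
    "upper_o2 (\<lambda>h. \<bar>log_cutoff (v + h) - log_cutoff v - p1 * h - p2 / 2 * h\<^sup>2\<bar>)"
    using log_cutoff_jet[OF v] by blast
  define t where "t = ((y - q) \<bullet> e1)\<^sup>2 + ((y - q) \<bullet> e2)\<^sup>2"
  obtain l1 l2 a' b c where J: "a' + c = 2 * k * p1 * (norm e1)\<^sup>2 + 2 * k\<^sup>2 * p2 * t"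
    "upper_o2 (\<lambda>w. \<bar>log_cutoff (k * (norm (y + Re w *\<^sub>R e1 + Im w *\<^sub>R e2 - q))\<^sup>2)
        - log_cutoff v - quad l1 l2 a' b c w\<bar>)"
    using radial_jet[OF e, of log_cutoff k y q p1 p2] p12(4) unfolding v_def t_def by blast
  have "k * t \<le> v * (norm e1)\<^sup>2"
    using conformal_bessel[OF e, of "y - q"] kA(1) by (simp add: t_def v_def mult.assoc)
  then have "p2 * (k * t) \<ge> p2 * (v * (norm e1)\<^sup>2)" using p12(1) by (rule mult_left_mono_neg)
  then have "p1 * (norm e1)\<^sup>2 + k * p2 * t \<ge> (p1 + v * p2) * (norm e1)\<^sup>2"
    by (simp add: algebra_simps)
  also have "(p1 + v * p2) * (norm e1)\<^sup>2 \<ge> -2 * (norm e1)\<^sup>2"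
    using p12(2) by (rule mult_right_mono) simp
  finally have "2 * k * A * (p1 * (norm e1)\<^sup>2 + k * p2 * t) \<ge> 2 * k * A * (-2 * (norm e1)\<^sup>2)"
    using kA by (intro mult_left_mono) auto
  moreover have "A * a' + A * c = 2 * k * A * (p1 * (norm e1)\<^sup>2 + k * p2 * t)"
    using arg_cong[OF J(1), of "\<lambda>x. A * x"] by (simp add: algebra_simps power2_eq_square)
  moreover have "2 * k * A = a" using kA(3) by (simp add: mult_ac)
  ultimately have "A * a' + A * c \<ge> - 2 * a * (norm e1)\<^sup>2" by simp
  moreover have "A * a' + A * c \<ge> 0" if "norm (y - q) \<ge> 2 * s"
  proof -
    have "v \<ge> 1" using power_mono[OF that, of 2] pos by (simp add: v_def k_def)
    then have "a' + c = 0" using p12(3) J(1) by simp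
    then show ?thesis by (simp add: distrib_left[symmetric])
  qed
  moreover have "upper_o2 (\<lambda>w. cutoff q y + quad (A * l1) (A * l2) (A * a') (A * b) (A * c) w
      - cutoff q (y + Re w *\<^sub>R e1 + Im w *\<^sub>R e2))"
  proof (rule upper_o2_mono[OF upper_o2_cmult[OF J(2), of A]])
    have cut: "cutoff q x = A * log_cutoff (k * (norm (x - q))\<^sup>2)" for x
      by (simp add: cutoff_def A_def k_def)
    show "\<forall>\<^sub>F w in nhds 0. cutoff q y + quad (A * l1) (A * l2) (A * a') (A * b) (A * c) w
      - cutoff q (y + Re w *\<^sub>R e1 + Im w *\<^sub>R e2)
      \<le> A * \<bar>log_cutoff (k * (norm (y + Re w *\<^sub>R e1 + Im w *\<^sub>R e2 - q))\<^sup>2)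
        - log_cutoff v - quad l1 l2 a' b c w\<bar>"
      unfolding cut v_def[symmetric] quad_cmult[symmetric] ring_distribs[symmetric]
      using kA(2) by (intro always_eventually allI mult_left_mono) auto
  qed (use kA in simp)
  ultimately show ?thesis by blast
qed

text \<open>A lower jet of the active branch of a maximum is a lower jet of the maximum, so the kink
  at radius \<open>s\<close> does no harm. On the sphere itself the zero branch is used.\<close>

lemma bump_jet:
  assumes e: "norm e1 = norm e2" "e1 \<bullet> e2 = 0"
  shows "\<exists>l1 l2 a' b c. a' + c \<ge> 0 \<and> (norm (y - p) > s \<longrightarrow> a' + c \<ge> 2 * a * (norm e1)\<^sup>2) \<and>
    upper_o2 (\<lambda>w. bump y + quad l1 l2 a' b c w - bump (y + Re w *\<^sub>R e1 + Im w *\<^sub>R e2))"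
proof (cases "norm (y - p) > s")
  case True
  have ident: "upper_o2 (\<lambda>h. \<bar>(\<lambda>x. x) (a * (norm (y - p))\<^sup>2 + h) - (\<lambda>x. x) (a * (norm (y - p))\<^sup>2) - 1 * h - 0 / 2 * h\<^sup>2\<bar>)"
    by (simp add: upper_o2_0)
  obtain l1 l2 a' b c where J: "a' + c = 2 * a * (norm e1)\<^sup>2"
    "upper_o2 (\<lambda>w. \<bar>a * (norm (y + Re w *\<^sub>R e1 + Im w *\<^sub>R e2 - p))\<^sup>2 - a * (norm (y - p))\<^sup>2 - quad l1 l2 a' b c w\<bar>)"
    using radial_jet[OF e ident] by auto
  have "bump y = a * (norm (y - p))\<^sup>2 - a * s\<^sup>2"
    using True pos power_mono[of s "norm (y - p)" 2] by (simp add: bump_def algebra_simps)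
  moreover have "bump x \<ge> a * (norm (x - p))\<^sup>2 - a * s\<^sup>2" for x
    using pos by (simp add: bump_def right_diff_distrib[symmetric] mult_left_mono)
  ultimately have "upper_o2 (\<lambda>w. bump y + quad l1 l2 a' b c w - bump (y + Re w *\<^sub>R e1 + Im w *\<^sub>R e2))"
    by (intro upper_o2_mono[OF J(2)] always_eventually allI) (smt (verit))
  then show ?thesis using J(1) pos by (intro exI[of _ l1] exI[of _ l2] exI[of _ a'] exI[of _ b] exI[of _ c]) auto
next
  case False
  then have "bump y = 0" using power_mono[of "norm (y - p)" s 2] by (simp add: bump_def)
  then have "upper_o2 (\<lambda>w. bump y + quad 0 0 0 0 0 w - bump (y + Re w *\<^sub>R e1 + Im w *\<^sub>R e2))"
    using bump_nonneg by (intro upper_o2_mono[OF upper_o2_0]) (simp add: quad_def)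
  then show ?thesis using False by (intro exI[of _ 0]) simp
qed

text \<open>Above the floor \<open>- 2 * m\<close> the barrier is locally \<open>u\<close> plus
  terms with lower jets, and \<open>bump\<close> has its full trace wherever the cutoff can have a
  negative one. The floor is met only outside the reach of the cutoff, and there the barrier has a
  local minimum; this also settles the seam, where both entries of the maximum coincide.\<close>

lemma viscosity_barrier:
  assumes y: "y \<in> \<Omega>" "y \<noteq> q" shows "viscosity_MPSH_at (barrier q) y"
proof (cases "base y > - 2 * m")
  case True
  then have yr: "norm (y - p) < r" and big: "u y + bump y > - 2 * m"
    by (auto simp: base_def split: if_splits)
  have yU: "y \<in> \<Omega> \<inter> U" using y yr ballU by (auto simp: dist_norm norm_minus_commute)
  have tri: "4 * s \<le> norm (y - q) + norm (y - p)"
    using q norm_triangle_ineq4[of "y - p" "y - q"] by (simp add: norm_minus_commute)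
  have jet: "lower_jet_MPSH_at (\<lambda>x. bump x + cutoff q x) y"
    unfolding lower_jet_MPSH_at_def
  proof (intro allI impI, elim conjE)
    fix e1 e2 :: 'a assume e: "norm e1 = norm e2" "e1 \<bullet> e2 = 0"
    obtain l1 l2 a' b c where B: "a' + c \<ge> 0" "norm (y - p) > s \<longrightarrow> a' + c \<ge> 2 * a * (norm e1)\<^sup>2"
      "upper_o2 (\<lambda>w. bump y + quad l1 l2 a' b c w - bump (y + Re w *\<^sub>R e1 + Im w *\<^sub>R e2))"
      using bump_jet[OF e, of y] by blast
    obtain k1 k2 a'' b' c' where C: "a'' + c' \<ge> - 2 * a * (norm e1)\<^sup>2" "norm (y - q) \<ge> 2 * s \<longrightarrow> a'' + c' \<ge> 0"
      "upper_o2 (\<lambda>w. cutoff q y + quad k1 k2 a'' b' c' w - cutoff q (y + Re w *\<^sub>R e1 + Im w *\<^sub>R e2))"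
      using cutoff_jet[OF y(2) e] by blast
    have "upper_o2 (\<lambda>w. (bump y + cutoff q y) + quad (l1 + k1) (l2 + k2) (a' + a'') (b + b') (c + c') w
        - (bump (y + Re w *\<^sub>R e1 + Im w *\<^sub>R e2) + cutoff q (y + Re w *\<^sub>R e1 + Im w *\<^sub>R e2)))"
      by (rule upper_o2_mono[OF upper_o2_add[OF B(3) C(3)]]) (simp add: quad_add[symmetric])
    moreover have "(a' + a'') + (c + c') \<ge> 0"
    proof (cases "norm (y - p) > s")
      case True
      then show ?thesis using B C by linarith
    next
      case False
      then have "norm (y - q) \<ge> 2 * s" using tri pos by linarith
      then show ?thesis using B C by linarith
    qed
    ultimately show "\<exists>l1 l2 a' b c. a' + c \<ge> 0 \<and> upper_o2 (\<lambda>w. (bump y + cutoff q y) + quad l1 l2 a' b c w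
        - (bump (y + Re w *\<^sub>R e1 + Im w *\<^sub>R e2) + cutoff q (y + Re w *\<^sub>R e1 + Im w *\<^sub>R e2)))"
      by blast
  qed
  have "\<forall>\<^sub>F x in nhds y. x \<in> ball p r"
    by (rule eventually_nhds_in_open) (use yr in \<open>auto simp: dist_norm norm_minus_commute\<close>)
  moreover have "\<forall>\<^sub>F x in nhds y. u x + bump x > - 2 * m"
    using tendsto_u_bump[OF y(1)] yr big by (auto intro: order_tendstoD(1))
  ultimately have "\<forall>\<^sub>F x in nhds y. barrier q x = u x + (bump x + cutoff q x)"
    by eventually_elim (auto simp: barrier_def base_def dist_norm norm_minus_commute)
  then show ?thesis by (rule viscosity_MPSH_add[OF visc_u[OF yU] jet])
next
  case False
  then have eq: "base y = - 2 * m" using base_ge[of y] by simp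
  have "norm (y - p) \<ge> 8 * s"
  proof (rule ccontr)
    assume "\<not> ?thesis"
    then show False
      using u_near[OF y(1)] bump_nonneg[of y] pos eq by (simp add: base_def max_def split: if_splits)
  qed
  then have yq: "norm (y - q) > 2 * s"
    using q pos norm_triangle_ineq[of "y - q" "q - p"] by simp
  have "open (- cball q (2 * s))" by auto
  then have "\<forall>\<^sub>F x in nhds y. x \<in> - cball q (2 * s)"
    by (rule eventually_nhds_in_open) (use yq in \<open>auto simp: dist_norm norm_minus_commute\<close>)
  then have "\<forall>\<^sub>F x in nhds y. barrier q y \<le> barrier q x"
  proof eventually_elim
    case (elim x)
    then have "cutoff q x = 0" by (intro cutoff_eq_0) (auto simp: dist_norm norm_minus_commute)
    moreover have "cutoff q y = 0" using yq by (intro cutoff_eq_0) simp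
    ultimately show ?case using base_ge[of x] eq by (simp add: barrier_def)
  qed
  then show ?thesis by (rule viscosity_MPSH_local_min)
qed

end

end

section \<open>The maximum principle with the Green function\<close>

lemma norm_sq_jet:
  fixes z :: complex
  shows "upper_o2 (\<lambda>w. \<bar>(norm (z + w))\<^sup>2 - (norm z)\<^sup>2 - quad (2 * Re z) (2 * Im z) 1 0 1 w\<bar>)"
proof -
  have "(norm (z + w))\<^sup>2 - (norm z)\<^sup>2 - quad (2 * Re z) (2 * Im z) 1 0 1 w = 0" for w
    unfolding quad_def cmod_power2 by (simp add: power2_eq_square algebra_simps)
  then show ?thesis by (simp add: upper_o2_0)
qed

text \<open>Up to the factor \<open>A\<close> and the last summand this is the Green function of the disc of radius \<open>t\<close>
  with pole at \<open>z0\<close>: the points \<open>z0\<close> and \<open>green_pole t z0\<close> are symmetric in the circle.\<close>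

definition green_pole :: "real \<Rightarrow> complex \<Rightarrow> complex" where
  "green_pole t z0 = of_real (t\<^sup>2) / cnj z0"

definition green_perturbed :: "real \<Rightarrow> real \<Rightarrow> real \<Rightarrow> complex \<Rightarrow> complex \<Rightarrow> real" where
  "green_perturbed A t \<epsilon> z0 z = A / 2 * (ln ((norm (z - green_pole t z0))\<^sup>2) - ln ((norm (z - z0))\<^sup>2))
     + A * ln (norm z0 / t) + \<epsilon> * ((norm z)\<^sup>2 - t\<^sup>2)"

lemma norm_green_pole: "norm (green_pole t z0) = t\<^sup>2 / norm z0"
  by (simp add: green_pole_def norm_divide norm_power)

lemma norm_less_green_pole:
  assumes "0 < norm z0" "norm z0 < t" "norm z \<le> t" shows "norm z < norm (green_pole t z0)"
proof -
  have "t > 0" using assms(1,2) by linarith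
  then have "t * norm z0 < t * t" using assms(2) by (intro mult_strict_left_mono)
  then have "t < t\<^sup>2 / norm z0" using assms(1) by (simp add: pos_less_divide_eq power2_eq_square)
  then show ?thesis using assms by (simp add: norm_green_pole)
qed

text \<open>Both logarithms are harmonic off their poles, so the trace comes from the last summand
  alone. This strictness is what the composition argument requires of \<open>S\<close>.\<close>

lemma green_perturbed_jet:
  assumes "A \<ge> 0" "\<epsilon> \<ge> 0" "z \<noteq> z0" "z \<noteq> green_pole t z0"
  shows "\<exists>l1 l2 a b c. a + c \<ge> 2 * \<epsilon> \<and> upper_o2 (\<lambda>w. green_perturbed A t \<epsilon> z0 z + quad l1 l2 a b c w
    - green_perturbed A t \<epsilon> z0 (z + w))"
proof -
  obtain l1 l2 a b c where 1: "a + c = 0" "upper_o2 (\<lambda>w. \<bar>ln ((norm (z + w - green_pole t z0))\<^sup>2)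
      - ln ((norm (z - green_pole t z0))\<^sup>2) - quad l1 l2 a b c w\<bar>)"
    using log_jet[OF assms(4)] by blast
  obtain k1 k2 a' b' c' where 2: "a' + c' = 0" "upper_o2 (\<lambda>w. \<bar>ln ((norm (z + w - z0))\<^sup>2)
      - ln ((norm (z - z0))\<^sup>2) - quad k1 k2 a' b' c' w\<bar>)"
    using log_jet[OF assms(3)] by blast
  define Q where "Q = (\<lambda>w. A/2 * (quad l1 l2 a b c w - quad k1 k2 a' b' c' w)
    + \<epsilon> * quad (2 * Re z) (2 * Im z) 1 0 1 w)"
  have "upper_o2 (\<lambda>w. (A/2 * \<bar>ln ((norm (z + w - green_pole t z0))\<^sup>2)
      - ln ((norm (z - green_pole t z0))\<^sup>2) - quad l1 l2 a b c w\<bar> + A/2 * \<bar>ln ((norm (z + w - z0))\<^sup>2)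
      - ln ((norm (z - z0))\<^sup>2) - quad k1 k2 a' b' c' w\<bar>)
      + \<epsilon> * \<bar>(norm (z + w))\<^sup>2 - (norm z)\<^sup>2 - quad (2 * Re z) (2 * Im z) 1 0 1 w\<bar>)"
    using assms by (intro upper_o2_add upper_o2_cmult 1 2 norm_sq_jet) auto
  then have "upper_o2 (\<lambda>w. green_perturbed A t \<epsilon> z0 z + Q w - green_perturbed A t \<epsilon> z0 (z + w))"
  proof (rule upper_o2_mono, intro always_eventually allI)
    fix w
    let ?x = "ln ((norm (z + w - green_pole t z0))\<^sup>2) - ln ((norm (z - green_pole t z0))\<^sup>2) - quad l1 l2 a b c w"
    let ?y = "ln ((norm (z + w - z0))\<^sup>2) - ln ((norm (z - z0))\<^sup>2) - quad k1 k2 a' b' c' w"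
    let ?v = "(norm (z + w))\<^sup>2 - (norm z)\<^sup>2 - quad (2 * Re z) (2 * Im z) 1 0 1 w"
    have "A/2 * (- ?x) \<le> A/2 * \<bar>?x\<bar>" "A/2 * ?y \<le> A/2 * \<bar>?y\<bar>" "\<epsilon> * (- ?v) \<le> \<epsilon> * \<bar>?v\<bar>"
      using assms by (intro mult_left_mono; simp)+
    moreover have "green_perturbed A t \<epsilon> z0 z + Q w - green_perturbed A t \<epsilon> z0 (z + w)
      = A/2 * (- ?x) + A/2 * ?y + \<epsilon> * (- ?v)"
      by (simp add: green_perturbed_def Q_def algebra_simps)
    ultimately show "green_perturbed A t \<epsilon> z0 z + Q w - green_perturbed A t \<epsilon> z0 (z + w)
      \<le> (A/2 * \<bar>?x\<bar> + A/2 * \<bar>?y\<bar>) + \<epsilon> * \<bar>?v\<bar>" by linarith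
  qed
  moreover have "Q w = quad (A/2 * (l1 - k1) + \<epsilon> * (2 * Re z)) (A/2 * (l2 - k2) + \<epsilon> * (2 * Im z))
      (A/2 * (a - a') + \<epsilon> * 1) (A/2 * (b - b') + \<epsilon> * 0) (A/2 * (c - c') + \<epsilon> * 1) w" for w
    unfolding Q_def quad_minus quad_cmult quad_add ..
  moreover have "(A/2 * (a - a') + \<epsilon> * 1) + (A/2 * (c - c') + \<epsilon> * 1) \<ge> 2 * \<epsilon>"
  proof -
    have "c = - a" "c' = - a'" using 1(1) 2(1) by linarith+
    then show ?thesis by (simp add: field_simps)
  qed
  ultimately show ?thesis by (simp only:) blast
qed

text \<open>On the circle \<open>t\<^sup>2 = z * cnj z\<close>, which factors
  \<open>z - green_pole t z0\<close>: the distances to the two poles are in constant ratio (circle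
  of Apollonius).\<close>

lemma green_perturbed_boundary:
  assumes "norm z = t" "t > 0" "z0 \<noteq> 0" "z \<noteq> z0"
  shows "green_perturbed A t \<epsilon> z0 z = 0"
proof -
  have "of_real (t\<^sup>2) = z * cnj z" using assms(1) complex_norm_square by metis
  then have "z - green_pole t z0 = z * cnj (z0 - z) / cnj z0"
    using assms(3) by (simp add: green_pole_def field_simps)
  then have n: "norm (z - green_pole t z0) = t * norm (z - z0) / norm z0"
    by (simp add: norm_divide norm_mult assms(1) norm_minus_commute del: complex_cnj_diff)
  have eq: "ln ((norm (z - green_pole t z0))\<^sup>2) - ln ((norm (z - z0))\<^sup>2) = 2 * ln t - 2 * ln (norm z0)"
    unfolding n using assms by (simp add: ln_realpow ln_mult ln_div)
  show ?thesis unfolding green_perturbed_def eq using assms by (simp add: ln_div algebra_simps)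
qed

lemma continuous_on_green_perturbed:
  assumes "z0 \<notin> X" "green_pole t z0 \<notin> X"
  shows "continuous_on X (green_perturbed A t \<epsilon> z0)"
  unfolding green_perturbed_def by (intro continuous_intros) (use assms in auto)

context peak_barrier
begin

text \<open>Maximum principle for the sum of the barrier along \<open>f\<close> and half of the Green function; the
  latter has the weaker singularity at \<open>z0\<close>.\<close>

lemma sphere_hitting_bound:
  assumes f: "f \<in> CH (ball 0 1) \<Omega>" and f0: "norm (f 0 - p) < s"
    and z0: "norm z0 < 1" "norm (f z0 - p) = 4 * s"
  shows "u (f 0) \<le> (2 * a * s\<^sup>2) * ln (norm z0)"
proof (rule ccontr)
  define q where "q = f z0"
  define A where "A = 2 * a * s\<^sup>2"
  have A: "A > 0" using pos by (simp add: A_def)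
  have q: "norm (q - p) = 4 * s" using z0 by (simp add: q_def)
  have conf: "conformal_map_on f (ball 0 1)" and harm: "harmonic_map_on f (ball 0 1)"
    and f\<Omega>: "f ` ball 0 1 \<subseteq> \<Omega>" using f by (auto simp: CH_def)
  have C1: "C1_map_on f (ball 0 1)" using conf by (simp add: conformal_map_on_def)
  have contf: "continuous_on (ball 0 1) f" using C1 by (rule C1_map_on_continuous_on)
  have "z0 \<noteq> 0" using z0(2) f0 pos by auto
  then have nz0: "norm z0 > 0" by simp
  have f0q: "f 0 \<noteq> q" using q f0 pos by auto
  assume "\<not> u (f 0) \<le> (2 * a * s\<^sup>2) * ln (norm z0)"
  then have "u (f 0) - A * ln (norm z0) > 0" by (simp add: A_def)
  then obtain \<gamma> where \<gamma>: "\<gamma> > 0" "u (f 0) - A * ln (norm z0) = 4 * \<gamma>"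
    by (metis divide_pos_pos nonzero_mult_div_cancel_left times_divide_eq_right zero_less_numeral zero_neq_numeral)
  \<comment> \<open>Nothing is known about \<open>f\<close> at the unit circle, hence a radius below
    \<open>1\<close>. The second entry limits the loss \<open>- A * ln t\<close> to
    \<open>\<gamma>\<close>; the perturbation costs at most another \<open>\<gamma>\<close> of the
    excess \<open>4 * \<gamma>\<close>.\<close>
  define t where "t = max ((1 + norm z0) / 2) (exp (- \<gamma> / A))"
  have t: "norm z0 < t" "t < 1" "t > 0" using z0(1) nz0 \<gamma>(1) A by (auto simp: t_def less_max_iff_disj)
  have "ln t \<ge> - \<gamma> / A" using t(3) by (simp add: ln_ge_iff t_def)
  then have lnt: "A * ln t \<ge> - \<gamma>" using A by (simp add: field_simps)
  define S where "S = green_perturbed A t \<gamma> z0"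
  define b where "b = green_pole t z0"
  define H where "H = (\<lambda>z. barrier q (f z) + S z)"
  have H0: "H 0 > 0"
  proof -
    have "S 0 = A * ln t - A * ln (norm z0) - \<gamma> * t\<^sup>2"
      using t nz0 by (simp add: S_def green_perturbed_def norm_green_pole ln_div ln_realpow algebra_simps)
    moreover have "\<gamma> * t\<^sup>2 \<le> \<gamma> * 1" using t \<gamma>(1) by (intro mult_left_mono) (auto simp: power_le_one)
    moreover have "barrier q (f 0) \<ge> u (f 0)" using q f0 by (intro barrier_ge_near) auto
    ultimately show ?thesis using \<gamma> lnt unfolding H_def by linarith
  qed
  \<comment> \<open>Where \<open>f z = q\<close> the real-valued logarithm is a default value
    instead of minus infinity, so \<open>H\<close> must be kept away from all such points, not only
    from \<open>z0\<close>. \<open>W\<close> detects them continuously: its numerator vanishes to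
    second order at \<open>z0\<close>, so the limit there is \<open>0\<close>, which is also the
    value of \<open>0 / 0\<close>.\<close>
  define W where "W = (\<lambda>z. (norm (f z - q))\<^sup>2 / norm (z - z0))"
  have W0: "W z \<ge> 0" for z by (simp add: W_def)
  have contW: "continuous_on (cball 0 t) W"
  proof (intro continuous_at_imp_continuous_on ballI)
    fix z :: complex assume "z \<in> cball 0 t"
    then have z: "z \<in> ball 0 1" using t(2) by simp
    have cz: "isCont f z" using contf z by (simp add: continuous_on_eq_continuous_at)
    show "isCont W z"
    proof (cases "z = z0")
      case False
      then show ?thesis unfolding W_def using cz by (intro continuous_intros) auto
    next
      case True
      have der: "(f has_derivative (\<lambda>w. Re w *\<^sub>R partial_x f z0 + Im w *\<^sub>R partial_y f z0)) (at z0)"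
        using has_derivative_partials[OF C1 z] True by simp
      then obtain d where d: "d > 0" "\<And>y. norm (y - z0) < d \<Longrightarrow> norm (f y - q
          - (Re (y - z0) *\<^sub>R partial_x f z0 + Im (y - z0) *\<^sub>R partial_y f z0)) \<le> 1 * norm (y - z0)"
        unfolding has_derivative_at_alt q_def using zero_less_one by blast
      define B where "B = norm (partial_x f z0) + norm (partial_y f z0) + 1"
      have WB: "W y \<le> B\<^sup>2 * norm (y - z0)" if y: "norm (y - z0) < d" for y
      proof -
        let ?L = "Re (y - z0) *\<^sub>R partial_x f z0 + Im (y - z0) *\<^sub>R partial_y f z0"
        have "norm ?L \<le> \<bar>Re (y - z0)\<bar> * norm (partial_x f z0) + \<bar>Im (y - z0)\<bar> * norm (partial_y f z0)"
          by (rule order_trans[OF norm_triangle_ineq]) simp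
        also have "\<dots> \<le> norm (y - z0) * norm (partial_x f z0) + norm (y - z0) * norm (partial_y f z0)"
          by (intro add_mono mult_right_mono abs_Re_le_cmod abs_Im_le_cmod) auto
        finally have "norm (f y - q) \<le> B * norm (y - z0)"
          using d(2)[OF y] norm_triangle_sub[of "f y - q" ?L] by (simp add: B_def algebra_simps)
        then have "(norm (f y - q))\<^sup>2 \<le> (B * norm (y - z0))\<^sup>2" by (intro power_mono) auto
        then show ?thesis
          unfolding W_def by (cases "y = z0") (simp_all add: field_simps power2_eq_square)
      qed
      have "(W \<longlongrightarrow> 0) (at z0)"
      proof (rule tendsto_sandwich)
        show "\<forall>\<^sub>F y in at z0. 0 \<le> W y" using W0 by simp
        show "\<forall>\<^sub>F y in at z0. W y \<le> B\<^sup>2 * norm (y - z0)"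
          unfolding eventually_at using d(1) WB by (auto simp: dist_norm)
        show "((\<lambda>y. B\<^sup>2 * norm (y - z0)) \<longlongrightarrow> 0) (at z0)"
          by (rule tendsto_eq_intros refl)+ simp
      qed simp
      then show ?thesis by (simp add: isCont_def W_def True q_def)
    qed
  qed
  \<comment> \<open>Gathers upper bounds for everything in \<open>H\<close> other than the two
    singular logarithms, which combine to \<open>A * ln (W z)\<close>.\<close>
  define C0 where "C0 = A * (3/2 - ln ((2 * s)\<^sup>2) + ln (t + norm b) + ln (norm z0 / t))"
  have HW: "H z \<le> A * ln (W z) + C0" if z: "z \<in> cball 0 t" "f z \<noteq> q" for z
  proof -
    have zz0: "z \<noteq> z0" using z(2) by (auto simp: q_def)
    have f\<Omega>z: "f z \<in> \<Omega>" using z t f\<Omega> by auto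
    have nb: "norm z < norm b" unfolding b_def using nz0 t z by (intro norm_less_green_pole) auto
    then have zb: "z \<noteq> b" by auto
    have lnb: "ln (norm (z - b)) \<le> ln (t + norm b)"
      using zb z norm_triangle_ineq4[of z b] by (subst ln_le_cancel_iff) (auto intro: add_pos_nonneg t(3))
    have "\<gamma> * ((norm z)\<^sup>2 - t\<^sup>2) \<le> 0"
      using z \<gamma>(1) by (intro mult_nonneg_nonpos) (auto simp: power_mono)
    moreover have "S z = A * (ln (norm (z - b)) - ln (norm (z - z0))) + A * ln (norm z0 / t) + \<gamma> * ((norm z)\<^sup>2 - t\<^sup>2)"
      using zb zz0 by (simp add: S_def green_perturbed_def b_def[symmetric] ln_realpow algebra_simps)
    moreover have "barrier q (f z) \<le> A * (ln ((norm (f z - q))\<^sup>2) - ln ((2 * s)\<^sup>2) + 3/2)"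
      using barrier_le_ln[OF q f\<Omega>z z(2)] z(2) pos by (simp add: A_def ln_div)
    moreover have lnW: "ln (W z) = ln ((norm (f z - q))\<^sup>2) - ln (norm (z - z0))"
      using zz0 z(2) by (simp add: W_def ln_div)
    ultimately show ?thesis
      using mult_left_mono[OF lnb, of A] A unfolding H_def C0_def lnW ring_distribs by linarith
  qed
  define w0 where "w0 = exp (- C0 / A)"
  have w0: "w0 > 0" by (simp add: w0_def)
  have Hneg: "H z < 0" if z: "z \<in> cball 0 t" "f z \<noteq> q" "W z < w0" for z
  proof -
    have "z \<noteq> z0" using z(2) by (auto simp: q_def)
    then have "W z > 0" using z(2) by (simp add: W_def)
    then have "ln (W z) < - C0 / A" using z(3) unfolding w0_def by (metis exp_gt_zero ln_exp ln_less_cancel_iff)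
    then have "A * ln (W z) + C0 < 0" using A by (simp add: field_simps)
    then show ?thesis using HW[OF z(1,2)] by simp
  qed
  \<comment> \<open>Discarding the points with \<open>W\<close> below \<open>w0\<close> loses no
    positive value of \<open>H\<close> and leaves a compact set free of singularities.\<close>
  define X where "X = cball 0 t \<inter> W -` {w0..}"
  have fX: "f z \<noteq> q" if "z \<in> X" for z using that w0 by (auto simp: X_def W_def)
  have "closed X" unfolding X_def
    by (rule continuous_closed_preimage[OF contW]) auto
  then have cX: "compact X" by (auto simp: X_def compact_eq_bounded_closed intro: bounded_subset[OF bounded_cball])
  have zero: "0 \<in> X" using Hneg[of 0] H0 f0q t(3) by (fastforce simp: X_def)
  have no_poles: "z0 \<notin> {z \<in> cball 0 t. f z \<noteq> q}" "green_pole t z0 \<notin> {z \<in> cball 0 t. f z \<noteq> q}"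
    using norm_less_green_pole[OF nz0 t(1)] by (auto simp: q_def)
  have contS: "continuous_on {z \<in> cball 0 t. f z \<noteq> q} S"
    unfolding S_def by (rule continuous_on_green_perturbed[OF no_poles])
  have contH: "continuous_on X H"
  proof -
    have XX: "X \<subseteq> {z \<in> cball 0 t. f z \<noteq> q}" using fX unfolding X_def by blast
    have X1: "X \<subseteq> ball 0 1" using t by (auto simp: X_def)
    have "continuous_on X (\<lambda>z. barrier q (f z))"
    proof (rule continuous_on_compose2[OF continuous_on_barrier[OF q]])
      show "continuous_on X f" using contf X1 by (rule continuous_on_subset)
      show "f ` X \<subseteq> \<Omega> - {q}" using fX X1 f\<Omega> by blast
    qed
    then show ?thesis unfolding H_def by (intro continuous_intros continuous_on_subset[OF contS XX])
  qed
  obtain z1 where z1: "z1 \<in> X" "\<And>z. z \<in> X \<Longrightarrow> H z \<le> H z1"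
    using continuous_attains_sup[OF cX _ contH] zero by blast
  have Hz1: "H z1 > 0" using z1(2)[OF zero] H0 by simp
  have z1t: "norm z1 < t"
  proof (rule ccontr)
    assume "\<not> norm z1 < t"
    then have "norm z1 = t" using z1(1) by (simp add: X_def)
    moreover have "z1 \<noteq> z0" using fX[OF z1(1)] by (auto simp: q_def)
    ultimately have "S z1 = 0" unfolding S_def using t(3) \<open>z0 \<noteq> 0\<close> by (intro green_perturbed_boundary)
    moreover have "barrier q (f z1) \<le> 0"
      using fX[OF z1(1)] f\<Omega> z1(1) t by (intro barrier_nonpos[OF q]) (auto simp: X_def)
    ultimately show False using Hz1 by (simp add: H_def)
  qed
  \<comment> \<open>An open set is needed, and it reaches beyond \<open>X\<close>. This is harmless:
    a point of \<open>D\<close> outside \<open>X\<close> has \<open>H < 0\<close> and cannot compete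
    with \<open>z1\<close>.\<close>
  define D where "D = ball 0 t \<inter> f -` (- {q})"
  have Dsub: "D \<subseteq> ball 0 1" "D \<subseteq> {z \<in> cball 0 t. f z \<noteq> q}" using t by (auto simp: D_def)
  have "open D" unfolding D_def
    by (rule continuous_open_preimage) (use t in \<open>auto intro: continuous_on_subset[OF contf]\<close>)
  have "\<exists>z\<in>D. barrier q (f z) + S z > barrier q (f z1) + S z1"
  proof (rule no_local_max_viscosity_compose[where h = "barrier q" and G = "\<Omega> - {q}" and \<kappa> = "2 * \<gamma>"])
    show "open (\<Omega> - {q})" using openG by auto
    show "continuous_on (\<Omega> - {q}) (barrier q)" by (rule continuous_on_barrier[OF q])
    show "viscosity_MPSH_at (barrier q) y" if "y \<in> \<Omega> - {q}" for y
      using that by (intro viscosity_barrier[OF q]) auto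
    show "open D" by fact
    show "conformal_map_on f D" "harmonic_map_on f D"
      using conf harm Dsub(1) by (auto intro: conformal_map_on_subset harmonic_map_on_subset)
    show "f ` D \<subseteq> \<Omega> - {q}" using Dsub f\<Omega> by auto
    show "continuous_on D S" by (rule continuous_on_subset[OF contS Dsub(2)])
    show "2 * \<gamma> > 0" using \<gamma> by simp
    show "\<exists>l1 l2 a b c. a + c \<ge> 2 * \<gamma> \<and> upper_o2 (\<lambda>w. S z + quad l1 l2 a b c w - S (z + w))"
      if "z \<in> D" for z
      unfolding S_def by (rule green_perturbed_jet) (use that no_poles Dsub(2) A \<gamma>(1) in auto)
    show "z1 \<in> D" using z1t fX[OF z1(1)] by (simp add: D_def)
  qed
  then obtain z where z: "z \<in> D" "H z > H z1" by (auto simp: H_def)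
  show False
  proof (cases "z \<in> X")
    case True
    then show False using z1(2) z(2) by force
  next
    case False
    then have "H z < 0" using z(1) Dsub(2) by (intro Hneg) (auto simp: X_def)
    then show False using z(2) Hz1 by simp
  qed
qed

end

section \<open>Comparison of the pseudometrics\<close>

lemma CH_rescale:
  fixes f :: "complex \<Rightarrow> 'a::euclidean_space"
  assumes f: "f \<in> CH (ball 0 1) \<Omega>" and s: "0 < s" "s \<le> 1" and B: "f ` ball 0 s \<subseteq> B"
  shows "(\<lambda>z. f (s *\<^sub>R z)) \<in> CH (ball 0 1) (\<Omega> \<inter> B)"
    and "partial_x (\<lambda>z. f (s *\<^sub>R z)) 0 = s *\<^sub>R partial_x f 0"
proof -
  have sz: "s *\<^sub>R z \<in> ball 0 s" "s *\<^sub>R z \<in> ball 0 1" if "z \<in> ball 0 1" for z :: complex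
  proof -
    have "norm (s *\<^sub>R z) < s" using that s(1) mult_strict_left_mono[of "norm z" 1 s] by simp
    moreover from this have "norm (s *\<^sub>R z) < 1" using s(2) by (rule less_le_trans)
    ultimately show "s *\<^sub>R z \<in> ball 0 s" "s *\<^sub>R z \<in> ball 0 1" by (simp_all only: mem_ball_0)
  qed
  \<comment> \<open>Serves the map with \<open>k = 1\<close> and its partial derivatives with
    \<open>k = s\<close>. Equality is asked on the disc only, because the partial derivatives of the
    rescaled map are not controlled outside it.\<close>
  have main: "C1_map_on h (ball 0 1) \<and> (\<forall>z\<in>ball 0 1. partial_x h z = (k * s) *\<^sub>R partial_x g (s *\<^sub>R z)
      \<and> partial_y h z = (k * s) *\<^sub>R partial_y g (s *\<^sub>R z))"
    if g: "C1_map_on g (ball 0 1)" and h: "\<And>z. z \<in> ball 0 1 \<Longrightarrow> h z = k *\<^sub>R g (s *\<^sub>R z)"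
    for g h :: "complex \<Rightarrow> 'a" and k
  proof -
    have der: "(h has_derivative (\<lambda>w. k *\<^sub>R (Re (s *\<^sub>R w) *\<^sub>R partial_x g (s *\<^sub>R z) + Im (s *\<^sub>R w) *\<^sub>R partial_y g (s *\<^sub>R z))))
        (at z)" if z: "z \<in> ball 0 1" for z
    proof (rule has_derivative_transform_within_open[OF _ open_ball z])
      have "((\<lambda>z. s *\<^sub>R z) has_derivative (\<lambda>w. s *\<^sub>R w)) (at z)" by (auto intro!: derivative_eq_intros)
      from has_derivative_compose[OF this has_derivative_partials[OF g sz(2)[OF z]]]
      show "((\<lambda>z. k *\<^sub>R g (s *\<^sub>R z)) has_derivative (\<lambda>w. k *\<^sub>R (Re (s *\<^sub>R w) *\<^sub>R partial_x g (s *\<^sub>R z)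
          + Im (s *\<^sub>R w) *\<^sub>R partial_y g (s *\<^sub>R z)))) (at z)"
        by (rule has_derivative_scaleR_right)
      show "k *\<^sub>R g (s *\<^sub>R x) = h x" if "x \<in> ball 0 1" for x using h[OF that] by simp
    qed
    then have p: "partial_x h z = (k * s) *\<^sub>R partial_x g (s *\<^sub>R z)"
        "partial_y h z = (k * s) *\<^sub>R partial_y g (s *\<^sub>R z)" if "z \<in> ball 0 1" for z
      using that by (simp_all add: partial_x_def partial_y_def frechet_derivative_at[OF der[OF that], symmetric])
    have "continuous_on (ball 0 1) (\<lambda>z. (k * s) *\<^sub>R partial_x g (s *\<^sub>R z))"
        "continuous_on (ball 0 1) (\<lambda>z. (k * s) *\<^sub>R partial_y g (s *\<^sub>R z))"
      using g sz(2) unfolding C1_map_on_def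
      by (auto intro!: continuous_intros intro: continuous_on_compose2[of "ball 0 1"])
    then have "continuous_on (ball 0 1) (partial_x h)" "continuous_on (ball 0 1) (partial_y h)"
      using p by (auto cong: continuous_on_cong_simp)
    then show ?thesis using p der unfolding C1_map_on_def differentiable_def by blast
  qed
  let ?g = "\<lambda>z. f (s *\<^sub>R z)"
  have C: "C1_map_on f (ball 0 1)" "C1_map_on (partial_x f) (ball 0 1)" "C1_map_on (partial_y f) (ball 0 1)"
    using f by (auto simp: CH_def harmonic_map_on_def C2_map_on_def)
  have 0: "C1_map_on ?g (ball 0 1)" "\<And>z. z \<in> ball 0 1 \<Longrightarrow> partial_x ?g z = s *\<^sub>R partial_x f (s *\<^sub>R z)"
    "\<And>z. z \<in> ball 0 1 \<Longrightarrow> partial_y ?g z = s *\<^sub>R partial_y f (s *\<^sub>R z)"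
    using main[OF C(1), of ?g 1] by auto
  have x: "C1_map_on (partial_x ?g) (ball 0 1)"
    "\<And>z. z \<in> ball 0 1 \<Longrightarrow> partial_x (partial_x ?g) z = (s * s) *\<^sub>R partial_x (partial_x f) (s *\<^sub>R z)"
    using main[OF C(2), of "partial_x ?g" s] 0 by auto
  have y: "C1_map_on (partial_y ?g) (ball 0 1)"
    "\<And>z. z \<in> ball 0 1 \<Longrightarrow> partial_y (partial_y ?g) z = (s * s) *\<^sub>R partial_y (partial_y f) (s *\<^sub>R z)"
    using main[OF C(3), of "partial_y ?g" s] 0 by auto
  show "partial_x ?g 0 = s *\<^sub>R partial_x f 0" using 0(2)[of 0] by simp
  have "conformal_map_on ?g (ball 0 1)"
    unfolding conformal_map_on_def
  proof (intro conjI ballI 0(1))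
    fix z :: complex assume z: "z \<in> ball 0 1"
    have "norm (partial_x f (s *\<^sub>R z)) = norm (partial_y f (s *\<^sub>R z))"
      "partial_x f (s *\<^sub>R z) \<bullet> partial_y f (s *\<^sub>R z) = 0"
      using f sz(2)[OF z] unfolding CH_def conformal_map_on_def by blast+
    then show "norm (partial_x ?g z) = norm (partial_y ?g z)" "partial_x ?g z \<bullet> partial_y ?g z = 0"
      by (simp_all add: 0(2,3)[OF z])
  qed
  moreover have "harmonic_map_on ?g (ball 0 1)"
    unfolding harmonic_map_on_def C2_map_on_def
  proof (intro conjI ballI 0(1) x(1) y(1))
    fix z :: complex assume z: "z \<in> ball 0 1"
    have "partial_x (partial_x f) (s *\<^sub>R z) + partial_y (partial_y f) (s *\<^sub>R z) = 0"
      using f sz(2)[OF z] unfolding CH_def harmonic_map_on_def by blast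
    then show "partial_x (partial_x ?g) z + partial_y (partial_y ?g) z = 0"
      unfolding x(2)[OF z] y(2)[OF z] scaleR_add_right[symmetric] by simp
  qed
  moreover have "?g ` ball 0 1 \<subseteq> \<Omega> \<inter> B"
  proof -
    have "f ` ball 0 1 \<subseteq> \<Omega>" using f by (simp add: CH_def)
    then show ?thesis using B sz by blast
  qed
  ultimately show "?g \<in> CH (ball 0 1) (\<Omega> \<inter> B)" by (simp add: CH_def)
qed

lemma CH_affine_disc:
  fixes x e1 e2 :: "'a::euclidean_space"
  assumes "norm e1 = norm e2" "e1 \<bullet> e2 = 0" "ball x d \<subseteq> G" "2 * norm e1 < d"
  defines "f \<equiv> \<lambda>z. x + Re z *\<^sub>R e1 + Im z *\<^sub>R e2"
  shows "f \<in> CH (ball 0 1) G" "f 0 = x" "partial_x f 0 = e1"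
proof -
  have der: "(f has_derivative (\<lambda>w. Re w *\<^sub>R e1 + Im w *\<^sub>R e2)) (at z)" for z
    unfolding f_def by (auto intro!: derivative_eq_intros)
  then have px: "partial_x f = (\<lambda>z. e1)" and py: "partial_y f = (\<lambda>z. e2)"
    by (auto simp: partial_x_def partial_y_def frechet_derivative_at[OF der, symmetric])
  have pc: "partial_x (\<lambda>z. c) = (\<lambda>z. 0)" "partial_y (\<lambda>z. c) = (\<lambda>z. 0)" for c :: 'a
    by (auto simp: partial_x_def partial_y_def)
  have "f z \<in> G" if "z \<in> ball 0 1" for z
  proof -
    have "norm (Re z *\<^sub>R e1 + Im z *\<^sub>R e2) \<le> \<bar>Re z\<bar> * norm e1 + \<bar>Im z\<bar> * norm e2"
      by (rule order_trans[OF norm_triangle_ineq]) simp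
    also have "\<dots> \<le> 1 * norm e1 + 1 * norm e2"
      using that abs_Re_le_cmod[of z] abs_Im_le_cmod[of z] by (intro add_mono mult_right_mono) auto
    also have "\<dots> < d" using assms(1,4) by simp
    also have "Re z *\<^sub>R e1 + Im z *\<^sub>R e2 = f z - x" by (simp add: f_def)
    finally have "f z \<in> ball x d" by (simp add: dist_norm norm_minus_commute)
    then show ?thesis using assms(3) by blast
  qed
  moreover have "f differentiable (at z)" for z using der by (auto simp: differentiable_def)
  ultimately show "f \<in> CH (ball 0 1) G"
    using assms(1,2)
    by (auto simp: CH_def harmonic_map_on_def C2_map_on_def conformal_map_on_def C1_map_on_def px py pc)
  show "f 0 = x" by (simp add: f_def)
  show "partial_x f 0 = e1" by (simp add: px)
qed

lemma minimal_pseudometric_set_nonempty: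
  fixes x v :: "'a::euclidean_space"
  assumes "DIM('a) \<ge> 2" "open G" "x \<in> G"
  shows "{1 / r | r. 1 / r > 0 \<and> (\<exists>f \<in> CH (ball 0 1) G. f 0 = x \<and> partial_x f 0 = r *\<^sub>R v)} \<noteq> {}"
proof -
  obtain d where d: "d > 0" "ball x d \<subseteq> G" using assms(2,3) open_contains_ball by blast
  obtain y where y: "y \<noteq> 0" "orthogonal v y" using orthogonal_to_vector_exists[OF assms(1)] by blast
  \<comment> \<open>The summand \<open>1\<close> covers \<open>v = 0\<close>.\<close>
  define r where "r = d / (2 * (norm v + 1))"
  have r: "r > 0" using d(1) by (simp add: r_def add_nonneg_pos)
  define e2 where "e2 = (r * norm v / norm y) *\<^sub>R y"
  have "norm (r *\<^sub>R v) = norm e2" using y(1) r by (simp add: e2_def)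
  moreover have "(r *\<^sub>R v) \<bullet> e2 = 0" using y(2) by (simp add: e2_def orthogonal_def)
  moreover have "2 * norm (r *\<^sub>R v) < d"
  proof -
    have "norm v / (norm v + 1) < 1" by (simp add: divide_simps add_nonneg_pos)
    then have "d * (norm v / (norm v + 1)) < d * 1" using d(1) by (intro mult_strict_left_mono)
    moreover have "2 * norm (r *\<^sub>R v) = d * (norm v / (norm v + 1))"
    proof -
      have "norm v + 1 \<noteq> 0" using norm_ge_zero[of v] by linarith
      have "2 * norm (r *\<^sub>R v) = 2 * r * norm v" using r by simp
      also have "\<dots> = d * (norm v / (norm v + 1))"
        unfolding r_def using \<open>norm v + 1 \<noteq> 0\<close> by (simp add: field_simps)
      finally show ?thesis .
    qed
    ultimately show ?thesis by simp
  qed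
  ultimately show ?thesis
    using CH_affine_disc[of "r *\<^sub>R v" e2 x d G] d(2) r by fastforce
qed

section \<open>Choice of the constants and conclusion\<close>

lemma compact_negative_bound:
  fixes u :: "'a::topological_space \<Rightarrow> real"
  assumes "compact X" "continuous_on X u" "\<And>x. x \<in> X \<Longrightarrow> u x < 0"
  obtains \<mu> where "\<mu> > 0" "\<And>x. x \<in> X \<Longrightarrow> u x \<le> - \<mu>"
proof (cases "X = {}")
  \<comment> \<open>The set may be empty, for instance when \<open>\<Omega>\<close> misses the
    sphere; any positive constant then serves.\<close>
  case True
  then show ?thesis using that[of 1] by simp
next
  case False
  then obtain x where "x \<in> X" "\<And>y. y \<in> X \<Longrightarrow> u y \<le> u x"
    using continuous_attains_sup[OF assms(1) _ assms(2)] by blast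
  then show ?thesis using that[of "- u x"] assms(3) by simp
qed

text \<open>The order of choice matters: \<open>r\<close>, then \<open>m\<close> from the gap of
  \<open>u\<close> on the sphere, then \<open>s\<close> from continuity at the boundary point
  \<open>p\<close>, and last \<open>a\<close> from the gap on a shell that depends on
  \<open>s\<close>. Working in the closure of \<open>\<Omega>\<close> makes sphere and shell
  compact.\<close>

lemma peak_barrier_exists:
  fixes \<Omega> U :: "'a::euclidean_space set"
  assumes op: "open \<Omega>" "open U" "p \<in> U" and p: "p \<in> closure \<Omega>"
    and cont: "continuous_on (closure \<Omega> \<inter> U) u"
    and nonpos: "\<forall>x \<in> closure \<Omega> \<inter> U. u x \<le> 0" and up: "u p = 0"
    and neg: "\<forall>x \<in> (closure \<Omega> \<inter> U) - {p}. u x < 0"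
    and M: "MPSH_on (\<Omega> \<inter> U) (\<lambda>x. ereal (u x))" and r0: "r0 > 0"
  obtains a s r m where "peak_barrier \<Omega> U u p a s r m" "4 * s < r0"
proof -
  obtain e where e: "e > 0" "cball p e \<subseteq> U" using op open_contains_cball by blast
  define r where "r = min e r0"
  have r: "r > 0" "r \<le> r0" "cball p r \<subseteq> U" using e r0 by (auto simp: r_def)
  have sub: "\<Omega> \<inter> U \<subseteq> closure \<Omega> \<inter> U" using closure_subset by blast
  have sphere: "compact (closure \<Omega> \<inter> sphere p r)" by (simp add: closed_Int_compact)
  obtain \<mu> where \<mu>: "\<mu> > 0" "\<And>x. x \<in> closure \<Omega> \<inter> sphere p r \<Longrightarrow> u x \<le> - \<mu>"
  proof (rule compact_negative_bound[OF sphere])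
    show "continuous_on (closure \<Omega> \<inter> sphere p r) u"
      by (rule continuous_on_subset[OF cont]) (use r in auto)
    show "u x < 0" if "x \<in> closure \<Omega> \<inter> sphere p r" for x
      using that r by (intro neg[rule_format]) auto
  qed blast
  define m where "m = \<mu> / 4"
  have m: "m > 0" using \<mu> by (simp add: m_def)
  have "p \<in> closure \<Omega> \<inter> U" using p op by blast
  then obtain d where d: "d > 0" "\<And>x. x \<in> closure \<Omega> \<inter> U \<Longrightarrow> dist x p < d \<Longrightarrow> dist (u x) (u p) < m"
    using cont m unfolding continuous_on_iff by blast
  define s where "s = min (d / 16) (r / 16)"
  have s: "s > 0" "8 * s < d" "8 * s < r" using d(1) r(1) by (auto simp: s_def min_less_iff_disj)
  have shell: "compact (closure \<Omega> \<inter> (cball p r - ball p s))"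
    by (simp add: closed_Int_compact compact_diff)
  obtain \<nu> where \<nu>: "\<nu> > 0" "\<And>x. x \<in> closure \<Omega> \<inter> (cball p r - ball p s) \<Longrightarrow> u x \<le> - \<nu>"
  proof (rule compact_negative_bound[OF shell])
    show "continuous_on (closure \<Omega> \<inter> (cball p r - ball p s)) u"
      by (rule continuous_on_subset[OF cont]) (use r in auto)
    show "u x < 0" if "x \<in> closure \<Omega> \<inter> (cball p r - ball p s)" for x
      using that r s by (intro neg[rule_format]) auto
  qed blast
  \<comment> \<open>The bound \<open>\<nu>\<close> secures the sign on the shell; the bound
    \<open>m\<close> leaves at most \<open>- 4 * m + m\<close>, still below \<open>- 2 * m\<close>,
    on the sphere.\<close>
  define a where "a = min \<nu> m / r\<^sup>2"
  have a: "a > 0" "a * r\<^sup>2 \<le> \<nu>" "a * r\<^sup>2 \<le> m" using \<nu> m r by (auto simp: a_def)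
  have ab: "a * ((norm (y - p))\<^sup>2 - s\<^sup>2) \<le> a * r\<^sup>2" if "norm (y - p) \<le> r" for y
    using that a(1) power_mono[OF that, of 2] by (intro mult_left_mono) (auto intro: order_trans[rotated])
  have "peak_barrier \<Omega> U u p a s r m"
  proof
    show "open \<Omega>" "open U" by fact+
    show "continuous_on (\<Omega> \<inter> U) u" by (rule continuous_on_subset[OF cont sub])
    show "u y \<le> 0" if "y \<in> \<Omega> \<inter> U" for y using that nonpos sub by blast
    then show "viscosity_MPSH_at u y" if "y \<in> \<Omega> \<inter> U" for y
      using MPSH_imp_viscosity_MPSH[OF M] that by blast
    show "cball p r \<subseteq> U" "s > 0" "8 * s < r" "a > 0" "m > 0" by fact+
  next
    fix y assume y: "y \<in> \<Omega>" "s \<le> norm (y - p)" "norm (y - p) \<le> r"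
    then have "y \<in> closure \<Omega> \<inter> (cball p r - ball p s)"
      using closure_subset by (auto simp: dist_norm norm_minus_commute)
    then show "u y + a * ((norm (y - p))\<^sup>2 - s\<^sup>2) \<le> 0" using \<nu>(2) ab[OF y(3)] a(2) by fastforce
  next
    fix y assume y: "y \<in> \<Omega>" "norm (y - p) = r"
    then have "y \<in> closure \<Omega> \<inter> sphere p r"
      using closure_subset by (auto simp: dist_norm norm_minus_commute)
    then have "u y \<le> - 4 * m" using \<mu>(2) by (simp add: m_def)
    then show "u y + a * ((norm (y - p))\<^sup>2 - s\<^sup>2) < - 2 * m" using ab[of y] y(2) a(3) m by linarith
  next
    fix y assume y: "y \<in> \<Omega>" "norm (y - p) < 8 * s"
    then have "y \<in> closure \<Omega> \<inter> U"
      using closure_subset r(3) s by (auto simp: dist_norm norm_minus_commute subset_iff)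
    then have "dist (u y) (u p) < m" using y s by (intro d(2)) (auto simp: dist_norm)
    then show "u y > - m" by (simp add: up dist_real_def)
  qed
  moreover have "4 * s < r0" using s r by linarith
  ultimately show ?thesis by (rule that)
qed

text \<open>A disc in \<open>\<Omega>\<close> shrunk by \<open>\<sigma>\<close> competes in the
  smaller set with its derivative multiplied by \<open>\<sigma>\<close>. When
  \<open>\<sigma>\<close> is not positive, nonnegativity of the infimum is enough.\<close>

lemma localized_minimal_pseudometric_le:
  fixes \<Omega> B :: "'a::euclidean_space set"
  assumes dim: "DIM('a) \<ge> 2" and op: "open \<Omega>" "open B" and x: "x \<in> \<Omega>" "x \<in> B"
    and image: "\<And>f. f \<in> CH (ball 0 1) \<Omega> \<Longrightarrow> f 0 = x \<Longrightarrow> f ` ball 0 \<sigma> \<subseteq> B"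
    and \<sigma>: "\<sigma> \<le> 1"
  shows "minimal_pseudometric \<Omega> x v \<ge> \<sigma> * minimal_pseudometric (\<Omega> \<inter> B) x v"
proof -
  let ?S = "\<lambda>G. {1 / r | r. 1 / r > 0 \<and> (\<exists>f \<in> CH (ball 0 1) G. f 0 = x \<and> partial_x f 0 = r *\<^sub>R v)}"
  have ne: "?S \<Omega> \<noteq> {}" "?S (\<Omega> \<inter> B) \<noteq> {}"
    using op x by (intro minimal_pseudometric_set_nonempty[OF dim]; auto)+
  have bdd: "bdd_below (?S (\<Omega> \<inter> B))" by (intro bdd_belowI[of _ 0]) auto
  show ?thesis
    unfolding minimal_pseudometric_def
  proof (rule cInf_greatest[OF ne(1)])
    fix y assume "y \<in> ?S \<Omega>"
    then obtain \<rho> f where f: "y = 1 / \<rho>" "1 / \<rho> > 0" "f \<in> CH (ball 0 1) \<Omega>" "f 0 = x" "partial_x f 0 = \<rho> *\<^sub>R v"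
      by blast
    show "\<sigma> * Inf (?S (\<Omega> \<inter> B)) \<le> y"
    proof (cases "\<sigma> > 0")
      case True
      let ?g = "\<lambda>z. f (\<sigma> *\<^sub>R z)"
      have "?g \<in> CH (ball 0 1) (\<Omega> \<inter> B)" "?g 0 = x" "partial_x ?g 0 = (\<sigma> * \<rho>) *\<^sub>R v"
        using CH_rescale[OF f(3) True \<sigma> image[OF f(3,4)]] f by auto
      moreover have "1 / (\<sigma> * \<rho>) > 0" using True f(2) by simp
      ultimately have "1 / (\<sigma> * \<rho>) \<in> ?S (\<Omega> \<inter> B)"
        by (intro CollectI exI[of _ "\<sigma> * \<rho>"] conjI refl bexI[of _ ?g])
      then have "Inf (?S (\<Omega> \<inter> B)) \<le> 1 / (\<sigma> * \<rho>)" using bdd by (rule cInf_lower)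
      then have "\<sigma> * Inf (?S (\<Omega> \<inter> B)) \<le> \<sigma> * (1 / (\<sigma> * \<rho>))" using True by (intro mult_left_mono) auto
      then show ?thesis using True f(1) by simp
    next
      case False
      have "Inf (?S (\<Omega> \<inter> B)) \<ge> 0" by (rule cInf_greatest[OF ne(2)]) auto
      then have "\<sigma> * Inf (?S (\<Omega> \<inter> B)) \<le> 0" using False by (intro mult_nonpos_nonneg) auto
      moreover have "y > 0" using f(1,2) by simp
      ultimately show ?thesis by linarith
    qed
  qed
qed

theorem theorem8p1:
  fixes \<Omega> U :: "(real ^ 'n) set" and p :: "real ^ 'n"
    and u :: "real ^ 'n \<Rightarrow> real" and c0 r0 :: real
  assumes "CARD('n) \<ge> 3"
    and "domain \<Omega>"
    and "p \<in> frontier \<Omega>"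
    and "open U" and "p \<in> U"
    and "continuous_on (closure \<Omega> \<inter> U) u"
    and "\<forall>x \<in> closure \<Omega> \<inter> U. u x \<le> 0"
    and "u p = 0"
    and "\<forall>x \<in> (closure \<Omega> \<inter> U) - {p}. u x < 0"
    and "MPSH_on (\<Omega> \<inter> U) (\<lambda>x. ereal (u x))"
    and "c0 > 0"
    and "\<forall>x \<in> \<Omega> \<inter> U. \<bar>u x\<bar> \<le> c0 * norm (x - p)"
    and "r0 > 0"
  shows "\<exists>c>0. \<forall>x \<in> \<Omega> \<inter> ball p r0. \<forall>v.
           minimal_pseudometric \<Omega> x v
             \<ge> (1 - c * norm (x - p)) * minimal_pseudometric (\<Omega> \<inter> ball p r0) x v"
proof -
  have op: "open \<Omega>" using assms(2) by (simp add: domain_def)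
  have dim: "DIM(real ^ 'n) \<ge> 2" using assms(1) by simp
  have "p \<in> closure \<Omega>" using assms(3) by (simp add: frontier_def)
  from peak_barrier_exists[OF op assms(4,5) this assms(6-10,13)]
  obtain a s r m where pb: "peak_barrier \<Omega> U u p a s r m" and sr0: "4 * s < r0" by metis
  interpret peak_barrier \<Omega> U u p a s r m by (rule pb)
  define A where "A = 2 * a * s\<^sup>2"
  have A: "A > 0" using pos by (simp add: A_def)
  \<comment> \<open>The entry \<open>1 / s\<close> makes the factor nonpositive for points at
    distance at least \<open>s\<close> from \<open>p\<close>; \<open>c0 / A\<close> is the rate
    resulting from the hitting bound and the linear growth of \<open>u\<close>.\<close>
  define c where "c = max (1 / s) (c0 / A)"
  have c: "c > 0" "1 / s \<le> c" "c0 / A \<le> c" using pos by (auto simp: c_def less_max_iff_disj)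
  have "minimal_pseudometric \<Omega> x v \<ge> (1 - c * norm (x - p)) * minimal_pseudometric (\<Omega> \<inter> ball p r0) x v"
    if x: "x \<in> \<Omega>" "x \<in> ball p r0" for x v
  proof (rule localized_minimal_pseudometric_le[OF dim op open_ball x])
    show "1 - c * norm (x - p) \<le> 1" using c(1) by simp
    fix f assume f: "f \<in> CH (ball 0 1) \<Omega>" "f 0 = x"
    show "f ` ball 0 (1 - c * norm (x - p)) \<subseteq> ball p r0"
    proof (cases "norm (x - p) < s")
      case False
      have "1 = 1 / s * s" using pos by simp
      also have "\<dots> \<le> c * norm (x - p)" using False c pos by (intro mult_mono) auto
      finally have "ball (0::complex) (1 - c * norm (x - p)) = {}" by (simp add: ball_empty)
      then show ?thesis by blast
    next
      case True
      define \<sigma> where "\<sigma> = 1 - c * norm (x - p)"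
      have "x \<in> \<Omega> \<inter> U" using x(1) True pos ballU by (auto simp: dist_norm norm_minus_commute subset_iff)
      then have "\<bar>u x\<bar> \<le> c0 * norm (x - p)" using assms(12) by blast
      then have ux: "u x \<ge> - (c0 * norm (x - p))" by linarith
      \<comment> \<open>Since \<open>ln (norm z) \<le> norm z - 1\<close>, a hit would force
        \<open>1 - norm z \<le> c * norm (x - p)\<close>, contrary to
        \<open>norm z < \<sigma>\<close>.\<close>
      have miss: "norm (f z - p) \<noteq> 4 * s" if z: "z \<in> ball 0 \<sigma>" for z
      proof
        assume hit: "norm (f z - p) = 4 * s"
        have "\<sigma> \<le> 1" using c(1) by (simp add: \<sigma>_def)
        then have z1: "norm z < 1" using z by simp
        have "u x \<le> A * ln (norm z)"
          using sphere_hitting_bound[OF f(1) _ z1 hit] True f(2) by (simp add: A_def)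
        moreover have "z \<noteq> 0" using hit f(2) True pos by auto
        then have "A * ln (norm z) \<le> A * (norm z - 1)"
          using A by (intro mult_left_mono ln_le_minus_one) auto
        ultimately have "A * (1 - norm z) \<le> c0 * norm (x - p)" using ux by (simp add: algebra_simps)
        then have "1 - norm z \<le> c0 / A * norm (x - p)" using A by (simp add: field_simps)
        also have "\<dots> \<le> c * norm (x - p)" using c(3) by (intro mult_right_mono) auto
        finally show False using z by (simp add: \<sigma>_def)
      qed
      \<comment> \<open>The disc starts below the level \<open>4 * s\<close> and never meets it, so
        connectedness keeps it below.\<close>
      have "norm (f z - p) < 4 * s" if z: "z \<in> ball 0 \<sigma>" for z
      proof (rule ccontr)
        assume far: "\<not> norm (f z - p) < 4 * s"
        have "ball 0 \<sigma> \<subseteq> ball (0::complex) 1" using c(1) by (intro subset_ball) (simp add: \<sigma>_def)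
        moreover have "continuous_on (ball 0 1) f"
          using f(1) by (auto simp: CH_def conformal_map_on_def intro: C1_map_on_continuous_on)
        ultimately have "continuous_on (ball 0 \<sigma>) (\<lambda>z. norm (f z - p))"
          by (intro continuous_intros) (rule continuous_on_subset)
        then have "connected ((\<lambda>z. norm (f z - p)) ` ball 0 \<sigma>)"
          by (rule connected_continuous_image) (rule connected_ball)
        moreover have "0 \<in> ball (0::complex) \<sigma>"
          using z le_less_trans[OF norm_ge_zero[of z]] by simp
        then have "norm (f 0 - p) \<in> (\<lambda>z. norm (f z - p)) ` ball 0 \<sigma>" by blast
        moreover have "norm (f z - p) \<in> (\<lambda>z. norm (f z - p)) ` ball 0 \<sigma>" using z by blast
        moreover have "norm (f 0 - p) \<le> 4 * s" using f(2) True pos(1) by simp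
        moreover have "4 * s \<le> norm (f z - p)" using far by simp
        ultimately have "4 * s \<in> (\<lambda>z. norm (f z - p)) ` ball 0 \<sigma>"
          by (rule connectedD_interval)
        then obtain z' where "4 * s = norm (f z' - p)" "z' \<in> ball 0 \<sigma>" by (rule imageE)
        then show False using miss[of z'] by simp
      qed
      then have "norm (f z - p) < r0" if "z \<in> ball 0 \<sigma>" for z
        using less_trans[OF _ sr0] that by blast
      then show ?thesis unfolding \<sigma>_def[symmetric]
        by (intro image_subsetI) (simp only: mem_ball dist_norm norm_minus_commute[of p])
    qed
  qed
  then show ?thesis using c(1) by blast
qed

end
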